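(* Let $(M_1^{n_1},F_1)$ and $(M_2^{n_2},F_2)$ be weakly Berwald Finsler manifolds and let $f$ be a positive smooth function on $M_1$. If $f$ is constant, then the Finsler warped product $(M,F)=M_1\times_f M_2$, with base $M_1$ and fiber $M_2$, is a weakly Berwald Finsler manifold.
   Context: A Finsler metric on a smooth manifold $M$ is a continuous $F:TM\to[0,\infty)$, smooth on $TM^0=TM\setminus\{0\}$, positively 1-homogeneous on fibers, with $g_{ij}=\frac12\frac{\partial^2F^2}{\partial y^i\partial y^j}$ positive definite on $TM^0$. Spray coefficients: $G^i=\frac14 g^{i\ell}\{[F^2]_{x^ky^\ell}y^k-[F^2]_{x^\ell}\}$. $(M,F)$ is weakly Berwald if the mean Berwald curvature $E_{ij}=\frac12\frac{\partial^2}{\partial y^i\partial y^j}\big(\frac{\partial G^s}{\partial y^s}\big)$ vanishes identically. The Finsler warped product $M=M_1\times_f M_2$ of a base $(M_1,F_1)$ and fiber $(M_2,F_2)$ with warping function $f>0$ smooth on $M_1$ is $M_1\times M_2$ with $F^2(x_1,y_1,x_2,y_2)=F_1^2(x_1,y_1)+f^2(x_1)F_2^2(x_2,y_2)$ on $TM_1^0\times TM_2^0$; its spray coefficients and curvatures are computed there by the formulas above. *)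

theory Defs
  imports "HOL-Analysis.Analysis"
begin

section \<open>Smooth maps between Euclidean spaces\<close>

fun Ck_on :: "nat \<Rightarrow> 'a::euclidean_space set \<Rightarrow> ('a \<Rightarrow> 'b::real_normed_vector) \<Rightarrow> bool" where
  "Ck_on 0 S h \<longleftrightarrow> continuous_on S h"
| "Ck_on (Suc k) S h \<longleftrightarrow>
     (\<forall>x\<in>S. h differentiable (at x)) \<and>
     (\<forall>v. Ck_on k S (\<lambda>x. frechet_derivative h (at x) v))"

text \<open>Openness of the domain is part of the notion: the derivatives above are full derivatives.\<close>

definition smooth_on :: "'a::euclidean_space set \<Rightarrow> ('a \<Rightarrow> 'b::real_normed_vector) \<Rightarrow> bool" where
  "smooth_on S h \<longleftrightarrow> open S \<and> (\<forall>k. Ck_on k S h)"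


section \<open>Smooth manifolds\<close>

text \<open>A chart is a pair of its domain and its coordinate map; values of the coordinate map outside
  the domain are irrelevant. The dimension is \<^term>\<open>CARD('n)\<close>. The carrier of a manifold is
  the carrier of a topology, and its smooth structure is given by an atlas, which may but need not
  be maximal.\<close>

type_synonym ('a, 'n) chart = "'a set \<times> ('a \<Rightarrow> (real, 'n) vec)"

definition chart_inv :: "('a, 'n::finite) chart \<Rightarrow> real ^ 'n \<Rightarrow> 'a" where
  "chart_inv c = inv_into (fst c) (snd c)"

definition chart_image :: "('a, 'n::finite) chart \<Rightarrow> (real ^ 'n) set" where
  "chart_image c = snd c ` fst c"

definition is_chart :: "'a topology \<Rightarrow> ('a, 'n::finite) chart \<Rightarrow> bool" where
  "is_chart X c \<longleftrightarrow> openin X (fst c) \<and> open (chart_image c) \<and>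
     homeomorphic_map (subtopology X (fst c)) (top_of_set (chart_image c)) (snd c)"

definition transition :: "('a, 'n::finite) chart \<Rightarrow> ('a, 'n) chart \<Rightarrow> real ^ 'n \<Rightarrow> real ^ 'n" where
  "transition c d = snd d \<circ> chart_inv c"

definition smooth_manifold :: "'a topology \<Rightarrow> ('a, 'n::finite) chart set \<Rightarrow> bool" where
  "smooth_manifold X A \<longleftrightarrow>
     Hausdorff_space X \<and> second_countable X \<and>
     (\<Union>c\<in>A. fst c) = topspace X \<and>
     (\<forall>c\<in>A. is_chart X c) \<and>
     (\<forall>c\<in>A. \<forall>d\<in>A. smooth_on (snd c ` (fst c \<inter> fst d)) (transition c d))"

definition smooth_function :: "('a, 'n::finite) chart set \<Rightarrow> ('a \<Rightarrow> real) \<Rightarrow> bool" where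
  "smooth_function A h \<longleftrightarrow> (\<forall>c\<in>A. smooth_on (chart_image c) (h \<circ> chart_inv c))"


section \<open>The tangent bundle\<close>

text \<open>A tangent vector at \<open>p\<close> is represented by the family of its coordinate vectors in all charts
  around \<open>p\<close>, related by the derivatives of the transition maps. The family is \<open>0\<close> at all
  other charts, so that it is uniquely determined by the tangent vector.\<close>

type_synonym ('a, 'n) tvec = "('a, 'n) chart \<Rightarrow> (real, 'n) vec"

definition tangent_space :: "('a, 'n::finite) chart set \<Rightarrow> 'a \<Rightarrow> ('a, 'n) tvec set" where
  "tangent_space A p = {v.
     (\<forall>c. \<not> (c \<in> A \<and> p \<in> fst c) \<longrightarrow> v c = 0) \<and>
     (\<forall>c\<in>A. \<forall>d\<in>A. p \<in> fst c \<and> p \<in> fst d \<longrightarrow>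
        v d = frechet_derivative (transition c d) (at (snd c p)) (v c))}"

definition tangent_bundle :: "('a, 'n::finite) chart set \<Rightarrow> ('a \<times> ('a, 'n) tvec) set" where
  "tangent_bundle A = (SIGMA p:(\<Union>c\<in>A. fst c). tangent_space A p)"

definition slit_tangent_bundle :: "('a, 'n::finite) chart set \<Rightarrow> ('a \<times> ('a, 'n) tvec) set" where
  "slit_tangent_bundle A = {(p, v) \<in> tangent_bundle A. v \<noteq> (\<lambda>_. 0)}"

text \<open>The element of the tangent bundle with coordinates \<open>(x, y)\<close> induced by the chart \<open>c\<close>.\<close>

definition tangent_of_coords ::
    "('a, 'n::finite) chart set \<Rightarrow> ('a, 'n) chart \<Rightarrow> (real ^ 'n) \<times> (real ^ 'n) \<Rightarrow> 'a \<times> ('a, 'n) tvec" where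
  "tangent_of_coords A c z =
     (chart_inv c (fst z),
      \<lambda>d. if d \<in> A \<and> chart_inv c (fst z) \<in> fst d
          then frechet_derivative (transition c d) (at (fst z)) (snd z) else 0)"

definition coord_domain ::
    "('a, 'n::finite) chart set \<Rightarrow> ('a, 'n) chart \<Rightarrow> ('a \<times> ('a, 'n) tvec) set \<Rightarrow> ((real ^ 'n) \<times> (real ^ 'n)) set" where
  "coord_domain A c D = {z. fst z \<in> chart_image c \<and> tangent_of_coords A c z \<in> D}"

text \<open>The differential of a smooth map \<open>h\<close>, as a map between tangent bundles. The result does not
  depend on the choice of the chart \<open>c\<close> around \<open>p\<close>.\<close>

definition differential ::
    "('a, 'm::finite) chart set \<Rightarrow> ('b, 'n::finite) chart set \<Rightarrow> ('a \<Rightarrow> 'b) \<Rightarrow>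
     'a \<times> ('a, 'm) tvec \<Rightarrow> 'b \<times> ('b, 'n) tvec" where
  "differential A B h w =
     (let p = fst w; c = (SOME c. c \<in> A \<and> p \<in> fst c) in
      (h p, \<lambda>d. if d \<in> B \<and> h p \<in> fst d
                then frechet_derivative (snd d \<circ> h \<circ> chart_inv c) (at (snd c p)) (snd w c) else 0))"


section \<open>Finsler metrics\<close>

text \<open>A Finsler metric \<open>F\<close> whose smoothness and strong convexity are only required on a part \<open>D\<close> of
  the slit tangent bundle; this is what a warped product needs. Smoothness entails that \<open>D\<close> is
  open. The usual notion is recovered when \<open>D\<close> is the whole slit tangent bundle.

  For a function \<open>L\<close> of the induced coordinates \<open>(x, y)\<close>, \<open>dx i L\<close> and \<open>dy i L\<close> are the partial
  derivatives with respect to the \<open>i\<close>-th component of \<open>x\<close> and of \<open>y\<close>.\<close>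

definition dx :: "'n::finite \<Rightarrow> ((real ^ 'n) \<times> (real ^ 'n) \<Rightarrow> real) \<Rightarrow> (real ^ 'n) \<times> (real ^ 'n) \<Rightarrow> real" where
  "dx i L z = deriv (\<lambda>t. L (fst z + t *\<^sub>R axis i 1, snd z)) 0"

definition dy :: "'n::finite \<Rightarrow> ((real ^ 'n) \<times> (real ^ 'n) \<Rightarrow> real) \<Rightarrow> (real ^ 'n) \<times> (real ^ 'n) \<Rightarrow> real" where
  "dy i L z = deriv (\<lambda>t. L (fst z, snd z + t *\<^sub>R axis i 1)) 0"

definition fundamental_tensor ::
    "((real ^ 'n) \<times> (real ^ 'n) \<Rightarrow> real) \<Rightarrow> (real ^ 'n) \<times> (real ^ 'n) \<Rightarrow> real ^ 'n ^ 'n::finite" where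
  "fundamental_tensor L z = (\<chi> i j. 1/2 * dy i (dy j (\<lambda>u. (L u)\<^sup>2)) z)"

definition spray_coeff ::
    "((real ^ 'n) \<times> (real ^ 'n) \<Rightarrow> real) \<Rightarrow> 'n::finite \<Rightarrow> (real ^ 'n) \<times> (real ^ 'n) \<Rightarrow> real" where
  "spray_coeff L i z =
     1/4 * (\<Sum>l\<in>UNIV. matrix_inv (fundamental_tensor L z) $ i $ l *
       ((\<Sum>k\<in>UNIV. dy l (dx k (\<lambda>u. (L u)\<^sup>2)) z * snd z $ k) - dx l (\<lambda>u. (L u)\<^sup>2) z))"

definition mean_berwald ::
    "((real ^ 'n) \<times> (real ^ 'n) \<Rightarrow> real) \<Rightarrow> 'n::finite \<Rightarrow> 'n \<Rightarrow> (real ^ 'n) \<times> (real ^ 'n) \<Rightarrow> real" where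
  "mean_berwald L i j z = 1/2 * dy i (dy j (\<lambda>u. \<Sum>s\<in>UNIV. dy s (spray_coeff L s) u)) z"

definition finsler_metric_on ::
    "('a, 'n::finite) chart set \<Rightarrow> ('a \<times> ('a, 'n) tvec) set \<Rightarrow> ('a \<times> ('a, 'n) tvec \<Rightarrow> real) \<Rightarrow> bool" where
  "finsler_metric_on A D F \<longleftrightarrow>
     D \<subseteq> slit_tangent_bundle A \<and>
     (\<forall>w\<in>tangent_bundle A. F w \<ge> 0) \<and>
     (\<forall>(p, v)\<in>tangent_bundle A. \<forall>r>0. F (p, \<lambda>c. r *\<^sub>R v c) = r * F (p, v)) \<and>
     (\<forall>c\<in>A. let L = F \<circ> tangent_of_coords A c in
        continuous_on (chart_image c \<times> UNIV) L \<and>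
        smooth_on (coord_domain A c D) L \<and>
        (\<forall>z\<in>coord_domain A c D. \<forall>\<xi>. \<xi> \<noteq> 0 \<longrightarrow> \<xi> \<bullet> (fundamental_tensor L z *v \<xi>) > 0))"

definition weakly_berwald_on ::
    "('a, 'n::finite) chart set \<Rightarrow> ('a \<times> ('a, 'n) tvec) set \<Rightarrow> ('a \<times> ('a, 'n) tvec \<Rightarrow> real) \<Rightarrow> bool" where
  "weakly_berwald_on A D F \<longleftrightarrow>
     (\<forall>c\<in>A. \<forall>z\<in>coord_domain A c D. \<forall>i j. mean_berwald (F \<circ> tangent_of_coords A c) i j z = 0)"

definition weakly_berwald_finsler_manifold_on ::
    "'a topology \<Rightarrow> ('a, 'n::finite) chart set \<Rightarrow> ('a \<times> ('a, 'n) tvec) set \<Rightarrow> ('a \<times> ('a, 'n) tvec \<Rightarrow> real) \<Rightarrow> bool" where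
  "weakly_berwald_finsler_manifold_on X A D F \<longleftrightarrow>
     smooth_manifold X A \<and> finsler_metric_on A D F \<and> weakly_berwald_on A D F"

definition weakly_berwald_finsler_manifold ::
    "'a topology \<Rightarrow> ('a, 'n::finite) chart set \<Rightarrow> ('a \<times> ('a, 'n) tvec \<Rightarrow> real) \<Rightarrow> bool" where
  "weakly_berwald_finsler_manifold X A F \<longleftrightarrow>
     weakly_berwald_finsler_manifold_on X A (slit_tangent_bundle A) F"


section \<open>Finsler warped products\<close>

definition join :: "real ^ 'm \<Rightarrow> real ^ 'n \<Rightarrow> real ^ ('m::finite + 'n::finite)" where
  "join x y = (\<chi> k. case k of Inl i \<Rightarrow> x $ i | Inr j \<Rightarrow> y $ j)"

definition prod_chart :: "('a, 'm::finite) chart \<Rightarrow> ('b, 'n::finite) chart \<Rightarrow> ('a \<times> 'b, 'm + 'n) chart" where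
  "prod_chart c d = (fst c \<times> fst d, \<lambda>(p, q). join (snd c p) (snd d q))"

definition prod_atlas ::
    "('a, 'm::finite) chart set \<Rightarrow> ('b, 'n::finite) chart set \<Rightarrow> ('a \<times> 'b, 'm + 'n) chart set" where
  "prod_atlas A B = (\<lambda>(c, d). prod_chart c d) ` (A \<times> B)"

text \<open>The subset of the tangent bundle of the product that corresponds to the product of the slit
  tangent bundles of the factors.\<close>

definition prod_slit_bundle ::
    "('a, 'm::finite) chart set \<Rightarrow> ('b, 'n::finite) chart set \<Rightarrow> (('a \<times> 'b) \<times> ('a \<times> 'b, 'm + 'n) tvec) set" where
  "prod_slit_bundle A B = {w \<in> tangent_bundle (prod_atlas A B).
     differential (prod_atlas A B) A fst w \<in> slit_tangent_bundle A \<and>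
     differential (prod_atlas A B) B snd w \<in> slit_tangent_bundle B}"

definition warped_metric ::
    "('a, 'm::finite) chart set \<Rightarrow> ('b, 'n::finite) chart set \<Rightarrow> ('a \<Rightarrow> real) \<Rightarrow>
     ('a \<times> ('a, 'm) tvec \<Rightarrow> real) \<Rightarrow> ('b \<times> ('b, 'n) tvec \<Rightarrow> real) \<Rightarrow>
     ('a \<times> 'b) \<times> ('a \<times> 'b, 'm + 'n) tvec \<Rightarrow> real" where
  "warped_metric A B f F1 F2 w =
     sqrt ((F1 (differential (prod_atlas A B) A fst w))\<^sup>2 +
           (f (fst (fst w)))\<^sup>2 * (F2 (differential (prod_atlas A B) B snd w))\<^sup>2)"

end

theory Submission
  imports Defs
begin

text \<open>In product charts, a constant warping function \<open>k\<close> gives \<open>F\<^sup>2 = F1\<^sup>2 + k\<^sup>2 F2\<^sup>2\<close> with separated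
  variables. Hence the fundamental tensor is block diagonal, the spray coefficients of the product are
  those of the factors, and the divergence of the spray is a sum of one function on each factor. Its
  mixed vertical second derivatives vanish, and the remaining ones are the mean Berwald curvatures of
  the factors. Smoothness of \<open>F\<close> rests on \<open>F1 \<noteq> 0\<close> off the zero section, which follows from Euler's
  identity and strong convexity.\<close>

section \<open>Calculus of smooth maps\<close>

text \<open>If the warping function varied, base derivatives of \<open>f\<^sup>2 F2\<^sup>2\<close>
  would couple the factors in the spray; constancy removes exactly this coupling. The predicate
  \<open>weakly_berwald_on\<close> ranges over the charts of the given atlas, and
  \<open>prod_atlas\<close> consists of product charts, so the computation stays in them and no
  transformation law for the curvature enters. The obstacle lies before the computation: tangent
  vectors are families over all charts and \<open>differential\<close> picks an arbitrary chart, so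
  both projections must first be identified with linear maps of coordinates. Partial derivatives are
  then treated as derivatives along lines. A linear projection carries lines to lines, and a term
  drops out as soon as the projected direction is zero.\<close>

lemma Ck_on_cong:
  assumes "open S" "\<And>x. x \<in> S \<Longrightarrow> g x = h x"
  shows "Ck_on k S g \<longleftrightarrow> Ck_on k S h"
proof -
  \<comment> \<open>One implication suffices by symmetry. Both functions are generalized because the
    induction passes to their derivatives.\<close>
  have "Ck_on k S h" if "Ck_on k S g" "\<And>x. x \<in> S \<Longrightarrow> g x = h x" for g h :: "'a \<Rightarrow> 'b"
    using that
  proof (induction k arbitrary: g h)
    case 0
    then show ?case
      by (metis Ck_on.simps(1) continuous_on_cong)
  next
    case (Suc k)
    have "h differentiable (at x)" if "x \<in> S" for x
      using Suc.prems that assms(1)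
      by (metis Ck_on.simps(2) differentiable_def has_derivative_transform_within_open)
    moreover have "Ck_on k S (\<lambda>x. frechet_derivative h (at x) v)" for v
    proof (rule Suc.IH)
      show "Ck_on k S (\<lambda>x. frechet_derivative g (at x) v)"
        using Suc.prems by simp
      \<comment> \<open>Openness of \<open>S\<close> makes the two maps agree near \<open>x\<close>,
        so their full derivatives coincide.\<close>
      show "frechet_derivative g (at x) v = frechet_derivative h (at x) v" if "x \<in> S" for x
        using Suc.prems that assms(1)
        by (metis Ck_on.simps(2) frechet_derivative_transform_within_open)
    qed
    ultimately show ?case by simp
  qed
  from this[of g h] this[of h g] show ?thesis
    using assms(2) by auto
qed

text \<open>Lets the derivative be supplied by a differentiation rule, so that
  \<open>frechet_derivative\<close> of a compound map never has to be computed.\<close>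

lemma Ck_on_SucI:
  assumes "open S" "\<And>x. x \<in> S \<Longrightarrow> (h has_derivative h' x) (at x)"
    and "\<And>v. Ck_on k S (\<lambda>x. h' x v)"
  shows "Ck_on (Suc k) S h"
proof -
  have "Ck_on k S (\<lambda>x. frechet_derivative h (at x) v)" for v
    using Ck_on_cong[OF assms(1), of "\<lambda>x. h' x v" "\<lambda>x. frechet_derivative h (at x) v"]
      assms(2,3) frechet_derivative_at by metis
  then show ?thesis
    using assms(2) by (auto simp: differentiable_def)
qed

lemma Ck_on_SucD:
  assumes "Ck_on (Suc k) S h" "x \<in> S"
  shows "(h has_derivative frechet_derivative h (at x)) (at x)"
  using assms by (simp flip: frechet_derivative_works)

lemma Ck_on_lower: "Ck_on (Suc k) S h \<Longrightarrow> Ck_on k S h"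
proof (induction k arbitrary: h)
  case 0
  then show ?case
    by (auto intro!: continuous_at_imp_continuous_on differentiable_imp_continuous_within)
next
  case (Suc k)
  then show ?case by (metis Ck_on.simps(2))
qed

lemma Ck_on_subset: "Ck_on k S h \<Longrightarrow> T \<subseteq> S \<Longrightarrow> Ck_on k T h"
  by (induction k arbitrary: h) (auto intro: continuous_on_subset)

lemma Ck_on_const: "Ck_on k S (\<lambda>x. c)"
  by (induction k arbitrary: c) auto

lemma Ck_on_add:
  assumes "open S"
  shows "Ck_on k S g \<Longrightarrow> Ck_on k S h \<Longrightarrow> Ck_on k S (\<lambda>x. g x + h x)"
proof (induction k arbitrary: g h)
  case 0
  then show ?case by (simp add: continuous_on_add)
next
  case (Suc k)
  show ?case
    by (rule Ck_on_SucI[OF assms has_derivative_add[OF Ck_on_SucD[OF Suc.prems(1)] Ck_on_SucD[OF Suc.prems(2)]]])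
      (use Suc in auto)
qed

text \<open>The product rule contains the undifferentiated factors, which are needed at the lower
  order; \<open>Ck_on_lower\<close> provides this.\<close>

lemma Ck_on_mult:
  fixes g h :: "'a::euclidean_space \<Rightarrow> real"
  assumes "open S"
  shows "Ck_on k S g \<Longrightarrow> Ck_on k S h \<Longrightarrow> Ck_on k S (\<lambda>x. g x * h x)"
proof (induction k arbitrary: g h)
  case 0
  then show ?case by (simp add: continuous_on_mult)
next
  case (Suc k)
  show ?case
    by (rule Ck_on_SucI[OF assms has_derivative_mult[OF Ck_on_SucD[OF Suc.prems(1)] Ck_on_SucD[OF Suc.prems(2)]]])
      (use Suc in \<open>auto intro!: Ck_on_add assms Suc.IH simp: Ck_on_lower[OF Suc.prems(1)] Ck_on_lower[OF Suc.prems(2)]\<close>)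
qed

lemma Ck_on_linear_left:
  assumes "open S" "bounded_linear J"
  shows "Ck_on k S h \<Longrightarrow> Ck_on k S (\<lambda>x. J (h x))"
proof (induction k arbitrary: h)
  case 0
  then show ?case
    using assms(2) by (simp add: bounded_linear.continuous_on)
next
  case (Suc k)
  show ?case
    by (rule Ck_on_SucI[OF assms(1) bounded_linear.has_derivative[OF assms(2) Ck_on_SucD[OF Suc.prems]]])
      (use Suc in auto)
qed

text \<open>For linear \<open>P\<close> the derivative of \<open>h (P x)\<close> along
  \<open>v\<close> is again a fixed directional derivative of \<open>h\<close>, along
  \<open>P v\<close>, composed with \<open>P\<close>. The induction therefore closes without a
  general higher-order chain rule.\<close>

lemma Ck_on_linear_right:
  assumes "open S" "bounded_linear P"
  shows "Ck_on k S h \<Longrightarrow> Ck_on k (P -` S) (\<lambda>x. h (P x))"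
proof (induction k arbitrary: h)
  case 0
  then show ?case
    using assms(2) by (auto intro: continuous_on_compose2 linear_continuous_on)
next
  case (Suc k)
  show ?case
  proof (rule Ck_on_SucI)
    show "open (P -` S)"
      using assms by (simp add: linear_continuous_at continuous_open_vimage)
    show "((\<lambda>x. h (P x)) has_derivative (\<lambda>v. frechet_derivative h (at (P x)) (P v))) (at x)"
      if "x \<in> P -` S" for x
      using that has_derivative_compose[OF bounded_linear_imp_has_derivative[OF assms(2)] Ck_on_SucD[OF Suc.prems]]
      by auto
    show "Ck_on k (P -` S) (\<lambda>x. frechet_derivative h (at (P x)) (P v))" for v
      using Suc by auto
  qed
qed

text \<open>Stated for all exponents at once, since differentiation lowers the exponent.\<close>

lemma Ck_on_powr:
  fixes h :: "'a::euclidean_space \<Rightarrow> real"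
  assumes "open S" "\<And>x. x \<in> S \<Longrightarrow> h x > 0"
  shows "Ck_on k S h \<Longrightarrow> Ck_on k S (\<lambda>x. h x powr a)"
proof (induction k arbitrary: a)
  case 0
  have "h x \<noteq> 0" if "x \<in> S" for x
    using assms(2)[OF that] by simp
  with 0 show ?case
    by (auto intro!: continuous_intros)
next
  case (Suc k)
  show ?case
  proof (rule Ck_on_SucI[OF assms(1)])
    show "((\<lambda>x. h x powr a) has_derivative (\<lambda>v. a * h x powr (a - 1) * frechet_derivative h (at x) v)) (at x)"
      if "x \<in> S" for x
    proof -
      have "((\<lambda>u. u powr a) has_derivative (\<lambda>v. a * h x powr (a - 1) * v)) (at (h x))"
        using has_real_derivative_powr[OF assms(2)[OF that], of a]
        by (simp add: has_field_derivative_def)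
      from has_derivative_compose[OF Ck_on_SucD[OF Suc.prems that] this] show ?thesis .
    qed
    show "Ck_on k S (\<lambda>x. a * h x powr (a - 1) * frechet_derivative h (at x) v)" for v
      using Suc.prems by (intro Ck_on_mult assms Ck_on_const Suc.IH Ck_on_lower[OF Suc.prems]) auto
  qed
qed

section \<open>Closure properties of smooth maps\<close>

lemma smooth_on_open: "smooth_on S h \<Longrightarrow> open S"
  by (simp add: smooth_on_def)

lemma smooth_on_differentiable: "smooth_on S h \<Longrightarrow> x \<in> S \<Longrightarrow> h differentiable (at x)"
  by (metis Ck_on.simps(2) smooth_on_def)

lemma smooth_on_cong:
  "smooth_on S g \<Longrightarrow> (\<And>x. x \<in> S \<Longrightarrow> g x = h x) \<Longrightarrow> smooth_on S h"
  unfolding smooth_on_def using Ck_on_cong by metis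

lemma smooth_on_subset: "smooth_on S h \<Longrightarrow> open T \<Longrightarrow> T \<subseteq> S \<Longrightarrow> smooth_on T h"
  unfolding smooth_on_def using Ck_on_subset by metis

lemma smooth_on_const: "open S \<Longrightarrow> smooth_on S (\<lambda>x. c)"
  by (simp add: smooth_on_def Ck_on_const)

lemma smooth_on_add: "smooth_on S g \<Longrightarrow> smooth_on S h \<Longrightarrow> smooth_on S (\<lambda>x. g x + h x)"
  by (simp add: smooth_on_def Ck_on_add)

lemma smooth_on_mult:
  fixes g h :: "'a::euclidean_space \<Rightarrow> real"
  shows "smooth_on S g \<Longrightarrow> smooth_on S h \<Longrightarrow> smooth_on S (\<lambda>x. g x * h x)"
  by (simp add: smooth_on_def Ck_on_mult)

lemma smooth_on_linear_left:
  "smooth_on S h \<Longrightarrow> bounded_linear J \<Longrightarrow> smooth_on S (\<lambda>x. J (h x))"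
  by (simp add: smooth_on_def Ck_on_linear_left)

lemma smooth_on_linear_right:
  "smooth_on S h \<Longrightarrow> bounded_linear P \<Longrightarrow> smooth_on (P -` S) (\<lambda>x. h (P x))"
  by (simp add: smooth_on_def Ck_on_linear_right linear_continuous_at continuous_open_vimage)

lemma smooth_on_sqrt:
  fixes h :: "'a::euclidean_space \<Rightarrow> real"
  assumes "smooth_on S h" "\<And>x. x \<in> S \<Longrightarrow> h x > 0"
  shows "smooth_on S (\<lambda>x. sqrt (h x))"
proof -
  have "smooth_on S (\<lambda>x. h x powr (1/2))"
    using assms by (simp add: smooth_on_def Ck_on_powr)
  then show ?thesis
    by (rule smooth_on_cong) (use assms(2) in \<open>simp add: powr_half_sqrt less_imp_le\<close>)
qed

lemma smooth_on_frechet_derivative: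
  assumes "smooth_on S h"
  shows "smooth_on S (\<lambda>x. frechet_derivative h (at x) v)"
  unfolding smooth_on_def
proof (intro conjI allI)
  fix k
  have "Ck_on (Suc k) S h"
    using assms unfolding smooth_on_def by blast
  then show "Ck_on k S (\<lambda>x. frechet_derivative h (at x) v)" by simp
qed (use assms smooth_on_open in blast)


section \<open>Directional derivatives\<close>

text \<open>A common form of \<open>dx\<close> and \<open>dy\<close>, which become the directions
  \<open>(axis i 1, 0)\<close> and \<open>(0, axis i 1)\<close>; rules about linear projections are
  then proved once for both.\<close>

definition dir_deriv :: "'a::euclidean_space \<Rightarrow> ('a \<Rightarrow> real) \<Rightarrow> 'a \<Rightarrow> real" where
  "dir_deriv w h z = deriv (\<lambda>t. h (z + t *\<^sub>R w)) 0"

lemma dx_eq_dir_deriv: "dx i = dir_deriv (axis i 1, 0)"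
  by (auto simp: fun_eq_iff dx_def dir_deriv_def plus_prod_def)

lemma dy_eq_dir_deriv: "dy i = dir_deriv (0, axis i 1)"
  by (auto simp: fun_eq_iff dy_def dir_deriv_def plus_prod_def)

lemma has_real_derivative_along:
  assumes "(h has_derivative h') (at z)"
  shows "((\<lambda>t. h (z + t *\<^sub>R w)) has_real_derivative h' w) (at 0)"
proof -
  have "((\<lambda>t. z + t *\<^sub>R w) has_derivative (\<lambda>t. t *\<^sub>R w)) (at 0)"
    by (auto intro!: derivative_eq_intros)
  from has_derivative_compose[OF this, of h h'] assms
  have "((\<lambda>t. h (z + t *\<^sub>R w)) has_derivative (\<lambda>t. h' (t *\<^sub>R w))) (at 0)" by simp
  moreover have "(\<lambda>t. h' (t *\<^sub>R w)) = (*) (h' w)"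
    using assms by (auto simp: fun_eq_iff has_derivative_linear linear_cmul)
  ultimately show ?thesis
    by (simp add: has_field_derivative_def)
qed

lemma dir_deriv_eq_frechet:
  "h differentiable (at z) \<Longrightarrow> dir_deriv w h z = frechet_derivative h (at z) w"
  unfolding dir_deriv_def frechet_derivative_works
  by (intro DERIV_imp_deriv has_real_derivative_along)

lemma smooth_on_dir_deriv:
  assumes "smooth_on S h"
  shows "smooth_on S (dir_deriv w h)"
  by (rule smooth_on_cong[OF smooth_on_frechet_derivative[OF assms, of w]])
    (simp add: dir_deriv_eq_frechet smooth_on_differentiable[OF assms])

lemma eventually_along:
  fixes z w :: "'a::real_normed_vector"
  assumes "open S" "z \<in> S"
  shows "\<forall>\<^sub>F t in nhds (0::real). z + t *\<^sub>R w \<in> S"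
proof -
  have "open ((\<lambda>t::real. z + t *\<^sub>R w) -` S)"
    using assms(1) by (intro continuous_open_vimage) (auto intro!: continuous_intros)
  then show ?thesis
    unfolding eventually_nhds using assms(2)
    by (intro exI[of _ "(\<lambda>t::real. z + t *\<^sub>R w) -` S"]) auto
qed

text \<open>\<open>deriv\<close> depends only on the germ of the function along the line, so
  agreement near \<open>z\<close> is enough even where no derivative exists.\<close>

lemma dir_deriv_cong:
  assumes "open S" "z \<in> S" "\<And>u. u \<in> S \<Longrightarrow> g u = h u"
  shows "dir_deriv w g z = dir_deriv w h z"
  unfolding dir_deriv_def
  by (intro deriv_cong_ev refl eventually_mono[OF eventually_along[OF assms(1,2)]]) (rule assms(3))

text \<open>Applied to the squared fibre metric and its first derivatives, which are smooth; the
  scale factor has cancelled before spray coefficients are differentiated.\<close>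

lemma dir_deriv_cmult:
  assumes "h differentiable (at z)"
  shows "dir_deriv w (\<lambda>u. c * h u) z = c * dir_deriv w h z"
  using has_real_derivative_along[OF frechet_derivative_works[THEN iffD1, OF assms], of w]
  unfolding dir_deriv_def by (intro deriv_cmult) (auto simp: field_differentiable_def)

text \<open>Adding a constant does not change which numbers are derivatives, so the next lemma also holds
  when \<^const>\<open>deriv\<close> is a junk value; the spray coefficients are never shown to be differentiable.\<close>

lemma dir_deriv_separated:
  assumes "open S" "z \<in> S" "\<And>u. u \<in> S \<Longrightarrow> h u = a (P u) + b (Q u)"
    and "linear P" "linear Q" "Q w = 0"
  shows "dir_deriv w h z = dir_deriv (P w) a (P z)"
proof -
  have "dir_deriv w h z = dir_deriv w (\<lambda>u. a (P u) + b (Q u)) z"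
    by (rule dir_deriv_cong[OF assms(1-3)])
  also have "\<dots> = deriv (\<lambda>t. a (P z + t *\<^sub>R P w) + b (Q z)) 0"
    using assms(4-6) by (simp add: dir_deriv_def linear_add linear_cmul)
  also have "\<dots> = dir_deriv (P w) a (P z)"
  proof -
    have "((\<lambda>t. a (P z + t *\<^sub>R P w) + b (Q z)) has_real_derivative D) (at 0) \<longleftrightarrow>
      ((\<lambda>t. a (P z + t *\<^sub>R P w)) has_real_derivative D) (at 0)" for D
    proof
      assume "((\<lambda>t. a (P z + t *\<^sub>R P w) + b (Q z)) has_real_derivative D) (at 0)"
      from DERIV_diff[OF this DERIV_const[of "b (Q z)"]]
      show "((\<lambda>t. a (P z + t *\<^sub>R P w)) has_real_derivative D) (at 0)" by simp
    next
      assume "((\<lambda>t. a (P z + t *\<^sub>R P w)) has_real_derivative D) (at 0)"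
      from DERIV_add[OF this DERIV_const[of "b (Q z)"]]
      show "((\<lambda>t. a (P z + t *\<^sub>R P w) + b (Q z)) has_real_derivative D) (at 0)" by simp
    qed
    then show ?thesis by (simp add: dir_deriv_def deriv_def)
  qed
  finally show ?thesis .
qed

text \<open>Since \<open>P\<close> kills the direction \<open>w\<close>, the function is constant
  along the line near \<open>z\<close>.\<close>

lemma dir_deriv_zero:
  assumes "open S" "z \<in> S" "\<And>u. u \<in> S \<Longrightarrow> h u = a (P u)" and "linear P" "P w = 0"
  shows "dir_deriv w h z = 0"
proof -
  have "dir_deriv w h z = dir_deriv w (\<lambda>u. a (P u)) z"
    by (rule dir_deriv_cong[OF assms(1-3)])
  then show ?thesis
    using assms(4,5) by (simp add: dir_deriv_def linear_add linear_cmul)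
qed

text \<open>Links the derivative along a ray in the fibre, where homogeneity can be used, to the
  partial derivatives that make up the fundamental tensor.\<close>

lemma dir_deriv_fibre_sum:
  fixes h :: "(real ^ 'n) \<times> (real ^ 'n::finite) \<Rightarrow> real"
  assumes "h differentiable (at z)"
  shows "dir_deriv (0, y) h z = (\<Sum>j\<in>UNIV. y $ j * dy j h z)"
proof -
  let ?D = "frechet_derivative h (at z)"
  have lin: "linear ?D" by (rule linear_frechet_derivative[OF assms])
  have "(0, y) = (\<Sum>j\<in>UNIV. y $ j *\<^sub>R (0 :: real ^ 'n, axis j 1 :: real ^ 'n))"
  proof -
    have "(\<Sum>j\<in>UNIV. y $ j *\<^sub>R axis j 1) = y"
      using basis_expansion[of y] by (simp add: scalar_mult_eq_scaleR)
    then show ?thesis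
      by (simp add: prod_eq_iff fst_sum snd_sum)
  qed
  then have "?D (0, y) = ?D (\<Sum>j\<in>UNIV. y $ j *\<^sub>R (0, axis j 1))" by (rule arg_cong)
  also have "\<dots> = (\<Sum>j\<in>UNIV. y $ j *\<^sub>R ?D (0, axis j 1))"
    by (simp add: linear_sum[OF lin] linear_cmul[OF lin] flip: scaleR_Pair)
  finally show ?thesis
    by (simp add: dir_deriv_eq_frechet[OF assms] dy_eq_dir_deriv)
qed


section \<open>Products of manifolds\<close>

definition join_fst :: "real ^ ('m::finite + 'n::finite) \<Rightarrow> real ^ 'm" where
  "join_fst z = (\<chi> i. z $ Inl i)"

definition join_snd :: "real ^ ('m::finite + 'n::finite) \<Rightarrow> real ^ 'n" where
  "join_snd z = (\<chi> j. z $ Inr j)"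

lemma join_nth [simp]: "join x y $ Inl i = x $ i" "join x y $ Inr j = y $ j"
  by (simp_all add: join_def)

lemma join_fst_nth [simp]: "join_fst z $ i = z $ Inl i"
  by (simp add: join_fst_def)

lemma join_snd_nth [simp]: "join_snd z $ j = z $ Inr j"
  by (simp add: join_snd_def)

lemma vec_sum_eq_iff:
  fixes u v :: "'a ^ ('m::finite + 'n::finite)"
  shows "u = v \<longleftrightarrow> (\<forall>i. u $ Inl i = v $ Inl i) \<and> (\<forall>j. u $ Inr j = v $ Inr j)"
  by (simp add: vec_eq_iff split_sum_all)

lemma join_fst_join [simp]: "join_fst (join x y) = x"
  by (simp add: vec_eq_iff)

lemma join_snd_join [simp]: "join_snd (join x y) = y"
  by (simp add: vec_eq_iff)

lemma join_fst_snd [simp]: "join (join_fst z) (join_snd z) = z"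
  by (simp add: vec_sum_eq_iff)

lemma join_eq_iff [simp]: "join x y = join x' y' \<longleftrightarrow> x = x' \<and> y = y'"
  by (metis join_fst_join join_snd_join)

lemma join_zero_iff: "z = 0 \<longleftrightarrow> join_fst z = 0 \<and> join_snd z = 0"
  by (simp add: vec_sum_eq_iff vec_eq_iff)

lemma bounded_linear_join_fst: "bounded_linear join_fst"
  by (rule linear_conv_bounded_linear[THEN iffD1], rule linearI) (auto simp: vec_eq_iff)

lemma bounded_linear_join_snd: "bounded_linear join_snd"
  by (rule linear_conv_bounded_linear[THEN iffD1], rule linearI) (auto simp: vec_eq_iff)

lemma bounded_linear_join_left: "bounded_linear (\<lambda>x. join x 0)"
  by (rule linear_conv_bounded_linear[THEN iffD1], rule linearI) (auto simp: vec_sum_eq_iff)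

lemma bounded_linear_join_right: "bounded_linear (\<lambda>y. join 0 y)"
  by (rule linear_conv_bounded_linear[THEN iffD1], rule linearI) (auto simp: vec_sum_eq_iff)

text \<open>Writes \<open>join\<close> as a sum of two linear maps of one argument each, so that
  continuity and smoothness reduce to the linear and additive rules.\<close>

lemma join_split: "join x y = join x 0 + join 0 y"
  by (simp add: vec_sum_eq_iff)

section \<open>Product charts and their transition maps\<close>

lemma is_chart_inj_on:
  assumes "is_chart X c"
  shows "inj_on (snd c) (fst c)"
proof -
  have "topspace (subtopology X (fst c)) = fst c"
    using assms openin_subset by (force simp: is_chart_def)
  then show ?thesis
    using assms by (auto simp: is_chart_def homeomorphic_eq_everything_map)
qed

lemma chart_inv_in: "x \<in> chart_image c \<Longrightarrow> chart_inv c x \<in> fst c"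
  unfolding chart_image_def chart_inv_def by (rule inv_into_into)

lemma chart_inv_right: "x \<in> chart_image c \<Longrightarrow> snd c (chart_inv c x) = x"
  unfolding chart_image_def chart_inv_def by (rule f_inv_into_f)

lemma chart_inv_left: "is_chart X c \<Longrightarrow> p \<in> fst c \<Longrightarrow> chart_inv c (snd c p) = p"
  unfolding chart_inv_def by (rule inv_into_f_f[OF is_chart_inj_on])

lemma chart_image_memI: "p \<in> fst c \<Longrightarrow> snd c p \<in> chart_image c"
  by (simp add: chart_image_def)

lemma fst_prod_chart [simp]: "fst (prod_chart c d) = fst c \<times> fst d"
  by (simp add: prod_chart_def)

lemma snd_prod_chart [simp]: "snd (prod_chart c d) (p, q) = join (snd c p) (snd d q)"
  by (simp add: prod_chart_def)

text \<open>Stated for arbitrary rectangles because it serves both whole chart domains and overlaps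
  of two charts.\<close>

lemma prod_chart_image:
  "snd (prod_chart c d) ` (S \<times> T) = join_fst -` (snd c ` S) \<inter> join_snd -` (snd d ` T)"
proof -
  have "z \<in> snd (prod_chart c d) ` (S \<times> T)" if "join_fst z = snd c p" "join_snd z = snd d q" "p \<in> S" "q \<in> T" for z p q
    using that by (intro image_eqI[of _ _ "(p, q)"]) (simp_all flip: that(1,2))
  then show ?thesis by auto
qed

lemma chart_image_prod_chart:
  "chart_image (prod_chart c d) = join_fst -` chart_image c \<inter> join_snd -` chart_image d"
  by (simp add: chart_image_def prod_chart_image)

lemma inj_on_prod_chart:
  assumes "is_chart X c" "is_chart Y d"
  shows "inj_on (snd (prod_chart c d)) (fst (prod_chart c d))"
  using is_chart_inj_on[OF assms(1)] is_chart_inj_on[OF assms(2)]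
  by (auto simp: inj_on_def)

text \<open>Outside the chart image \<open>inv_into\<close> takes arbitrary values, so the formula
  is local; later uses transfer it along open sets.\<close>

lemma chart_inv_prod_chart:
  assumes "is_chart X c" "is_chart Y d" "z \<in> chart_image (prod_chart c d)"
  shows "chart_inv (prod_chart c d) z = (chart_inv c (join_fst z), chart_inv d (join_snd z))"
  unfolding chart_inv_def[of "prod_chart c d"]
proof (rule inv_into_f_eq[OF inj_on_prod_chart[OF assms(1,2)]])
  have z: "join_fst z \<in> chart_image c" "join_snd z \<in> chart_image d"
    using assms(3) by (auto simp: chart_image_prod_chart)
  show "(chart_inv c (join_fst z), chart_inv d (join_snd z)) \<in> fst (prod_chart c d)"
    using z by (simp add: chart_inv_in)
  show "snd (prod_chart c d) (chart_inv c (join_fst z), chart_inv d (join_snd z)) = z"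
    using z by (simp add: chart_inv_right)
qed

lemma open_vimage_join:
  assumes "open S" "open T"
  shows "open (join_fst -` S \<inter> join_snd -` T)"
  using assms
  by (intro open_Int continuous_open_vimage)
    (simp_all add: linear_continuous_at bounded_linear_join_fst bounded_linear_join_snd)

text \<open>The product chart factors through the Cartesian product of the two coordinate spaces: a
  product of homeomorphisms followed by \<open>join\<close>, which is itself a homeomorphism onto
  the chart image.\<close>

lemma is_chart_prod_chart:
  fixes c :: "('a, 'm::finite) chart" and d :: "('b, 'n::finite) chart"
  assumes c: "is_chart X c" and d: "is_chart Y d"
  shows "is_chart (prod_topology X Y) (prod_chart c d)"
  unfolding is_chart_def
proof (intro conjI)
  show "openin (prod_topology X Y) (fst (prod_chart c d))"
    using c d by (simp add: is_chart_def openin_prod_Times_iff)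
  show "open (chart_image (prod_chart c d))"
    using c d unfolding chart_image_prod_chart by (simp add: is_chart_def open_vimage_join)
  obtain c' where c': "homeomorphic_maps (subtopology X (fst c)) (top_of_set (chart_image c)) (snd c) c'"
    using c unfolding is_chart_def homeomorphic_map_maps by blast
  obtain d' where d': "homeomorphic_maps (subtopology Y (fst d)) (top_of_set (chart_image d)) (snd d) d'"
    using d unfolding is_chart_def homeomorphic_map_maps by blast
  have "homeomorphic_maps (prod_topology (subtopology X (fst c)) (subtopology Y (fst d)))
     (prod_topology (top_of_set (chart_image c)) (top_of_set (chart_image d)))
     (\<lambda>(p, q). (snd c p, snd d q)) (\<lambda>(p, q). (c' p, d' q))"
    using c' d' by (simp only: homeomorphic_maps_prod simp_thms)
  then have 1: "homeomorphic_map (subtopology (prod_topology X Y) (fst c \<times> fst d))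
     (top_of_set (chart_image c \<times> chart_image d)) (\<lambda>(p, q). (snd c p, snd d q))"
    by (auto simp: homeomorphic_map_maps subtopology_Times)
  have "homeomorphic_maps (top_of_set (chart_image c \<times> chart_image d))
      (top_of_set (chart_image (prod_chart c d))) (\<lambda>(x, y). join x y) (\<lambda>z. (join_fst z, join_snd z))"
  proof -
    have "continuous_on U (\<lambda>z. join (fst z) 0 + join 0 (snd z))"
      for U :: "((real ^ 'm) \<times> (real ^ 'n)) set"
      by (intro continuous_intros bounded_linear.continuous_on[OF bounded_linear_join_left]
          bounded_linear.continuous_on[OF bounded_linear_join_right])
    then have "continuous_on U (\<lambda>z. join (fst z) (snd z))" for U :: "((real ^ 'm) \<times> (real ^ 'n)) set"
      by (rule continuous_on_eq) (rule join_split[symmetric])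
    moreover have "continuous_on U (\<lambda>z. (join_fst z, join_snd z))" for U :: "(real ^ ('m + 'n)) set"
      by (intro continuous_intros linear_continuous_on bounded_linear_join_fst bounded_linear_join_snd)
    ultimately show ?thesis
      by (auto simp: homeomorphic_maps_def case_prod_unfold chart_image_prod_chart)
  qed
  then have 2: "homeomorphic_map (top_of_set (chart_image c \<times> chart_image d))
      (top_of_set (chart_image (prod_chart c d))) (\<lambda>(x, y). join x y)"
    by (auto simp: homeomorphic_map_maps)
  have "snd (prod_chart c d) = (\<lambda>(x, y). join x y) \<circ> (\<lambda>(p, q). (snd c p, snd d q))"
    by (auto simp: fun_eq_iff)
  then show "homeomorphic_map (subtopology (prod_topology X Y) (fst (prod_chart c d)))
     (top_of_set (chart_image (prod_chart c d))) (snd (prod_chart c d))"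
    using homeomorphic_map_compose[OF 1 2] by simp
qed

lemma smooth_on_join:
  assumes "smooth_on S g" "smooth_on T h"
  shows "smooth_on (join_fst -` S \<inter> join_snd -` T) (\<lambda>z. join (g (join_fst z)) (h (join_snd z)))"
proof -
  let ?U = "join_fst -` S \<inter> join_snd -` T"
  have U: "open ?U"
    using assms by (simp add: open_vimage_join smooth_on_open)
  have "smooth_on ?U (\<lambda>z. join (g (join_fst z)) 0)"
    by (rule smooth_on_subset[OF smooth_on_linear_left[OF
      smooth_on_linear_right[OF assms(1) bounded_linear_join_fst] bounded_linear_join_left] U]) simp
  moreover have "smooth_on ?U (\<lambda>z. join 0 (h (join_snd z)))"
    by (rule smooth_on_subset[OF smooth_on_linear_left[OF
      smooth_on_linear_right[OF assms(2) bounded_linear_join_snd] bounded_linear_join_right] U]) simp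
  ultimately have "smooth_on ?U (\<lambda>z. join (g (join_fst z)) 0 + join 0 (h (join_snd z)))"
    by (rule smooth_on_add)
  then show ?thesis by (rule smooth_on_cong) (rule join_split[symmetric])
qed

text \<open>Rectangles of members of two countable bases form a countable base of the
  product.\<close>

lemma second_countable_prod_topology:
  assumes "second_countable X" "second_countable Y"
  shows "second_countable (prod_topology X Y)"
proof -
  obtain B where B: "countable B" "\<And>V. V \<in> B \<Longrightarrow> openin X V"
    "\<And>U x. openin X U \<Longrightarrow> x \<in> U \<Longrightarrow> \<exists>V\<in>B. x \<in> V \<and> V \<subseteq> U"
    using assms(1) by (auto simp: second_countable_def)
  obtain C where C: "countable C" "\<And>V. V \<in> C \<Longrightarrow> openin Y V"
    "\<And>U x. openin Y U \<Longrightarrow> x \<in> U \<Longrightarrow> \<exists>V\<in>C. x \<in> V \<and> V \<subseteq> U"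
    using assms(2) by (auto simp: second_countable_def)
  show ?thesis
    unfolding second_countable_def
  proof (intro exI[of _ "(\<lambda>(V, W). V \<times> W) ` (B \<times> C)"] conjI ballI allI impI)
    show "countable ((\<lambda>(V, W). V \<times> W) ` (B \<times> C))"
      using B(1) C(1) by simp
    show "openin (prod_topology X Y) V" if "V \<in> (\<lambda>(V, W). V \<times> W) ` (B \<times> C)" for V
      using that B(2) C(2) by (auto simp: openin_prod_Times_iff)
    fix U z
    assume "openin (prod_topology X Y) U \<and> z \<in> U"
    then obtain S T where "openin X S" "openin Y T" "fst z \<in> S" "snd z \<in> T" "S \<times> T \<subseteq> U"
      unfolding openin_prod_topology_alt by (metis prod.collapse)
    moreover from this obtain V W where "V \<in> B" "fst z \<in> V" "V \<subseteq> S" "W \<in> C" "snd z \<in> W" "W \<subseteq> T"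
      using B(3) C(3) by meson
    ultimately show "\<exists>V\<in>(\<lambda>(V, W). V \<times> W) ` (B \<times> C). z \<in> V \<and> V \<subseteq> U"
      by (intro bexI[of _ "V \<times> W"]) (auto simp: mem_Times_iff)
  qed
qed

lemma smooth_manifold_chart: "smooth_manifold X A \<Longrightarrow> c \<in> A \<Longrightarrow> is_chart X c"
  by (simp add: smooth_manifold_def)

lemma smooth_manifold_transition:
  "smooth_manifold X A \<Longrightarrow> c \<in> A \<Longrightarrow> d \<in> A \<Longrightarrow> smooth_on (snd c ` (fst c \<inter> fst d)) (transition c d)"
  by (simp add: smooth_manifold_def)

lemma transition_prod_chart:
  assumes "is_chart X c" "is_chart Y d" "z \<in> chart_image (prod_chart c d)"
  shows "transition (prod_chart c d) (prod_chart c' d') z =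
    join (transition c c' (join_fst z)) (transition d d' (join_snd z))"
  by (simp add: transition_def chart_inv_prod_chart[OF assms])

lemma prod_atlasE:
  assumes "e \<in> prod_atlas A B"
  obtains c d where "e = prod_chart c d" "c \<in> A" "d \<in> B"
  using assms by (auto simp: prod_atlas_def)

lemma prod_chart_in_prod_atlas: "c \<in> A \<Longrightarrow> d \<in> B \<Longrightarrow> prod_chart c d \<in> prod_atlas A B"
  by (auto simp: prod_atlas_def)

lemma smooth_manifold_prod:
  assumes X: "smooth_manifold X A" and Y: "smooth_manifold Y B"
  shows "smooth_manifold (prod_topology X Y) (prod_atlas A B)"
  unfolding smooth_manifold_def
proof (intro conjI ballI)
  show "Hausdorff_space (prod_topology X Y)" "second_countable (prod_topology X Y)"
    using X Y by (auto simp: smooth_manifold_def Hausdorff_space_prod_topology second_countable_prod_topology)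
  show "(\<Union>c\<in>prod_atlas A B. fst c) = topspace (prod_topology X Y)"
  proof -
    have "(\<Union>c\<in>prod_atlas A B. fst c) = (\<Union>c\<in>A. fst c) \<times> (\<Union>d\<in>B. fst d)"
      unfolding prod_atlas_def by auto
    then show ?thesis
      using X Y by (simp add: smooth_manifold_def)
  qed
  show "is_chart (prod_topology X Y) e" if "e \<in> prod_atlas A B" for e
    using that by (metis prod_atlasE is_chart_prod_chart smooth_manifold_chart[OF X] smooth_manifold_chart[OF Y])
  fix e e'
  assume "e \<in> prod_atlas A B" "e' \<in> prod_atlas A B"
  then obtain c d c' d' where e: "e = prod_chart c d" "e' = prod_chart c' d'"
    and cd: "c \<in> A" "d \<in> B" "c' \<in> A" "d' \<in> B"
    by (metis prod_atlasE)
  \<comment> \<open>Two rectangles meet in a rectangle, on which the transition map acts separately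
    on the two blocks of coordinates.\<close>
  show "smooth_on (snd e ` (fst e \<inter> fst e')) (transition e e')"
    unfolding e fst_prod_chart Times_Int_Times prod_chart_image
  proof (rule smooth_on_cong[OF smooth_on_join])
    show "smooth_on (snd c ` (fst c \<inter> fst c')) (transition c c')"
      "smooth_on (snd d ` (fst d \<inter> fst d')) (transition d d')"
      using X Y cd by (auto intro: smooth_manifold_transition)
    fix z
    assume "z \<in> join_fst -` (snd c ` (fst c \<inter> fst c')) \<inter> join_snd -` (snd d ` (fst d \<inter> fst d'))"
    then have "z \<in> chart_image (prod_chart c d)"
      by (auto simp: chart_image_prod_chart intro: chart_image_memI)
    then show "join (transition c c' (join_fst z)) (transition d d' (join_snd z)) =
        transition (prod_chart c d) (prod_chart c' d') z"
      using transition_prod_chart[OF smooth_manifold_chart[OF X cd(1)] smooth_manifold_chart[OF Y cd(2)]]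
      by metis
  qed
qed


section \<open>Coordinates on the tangent bundle\<close>

lemma transition_differentiable:
  assumes "smooth_manifold X A" "c \<in> A" "d \<in> A" "p \<in> fst c" "p \<in> fst d"
  shows "transition c d differentiable (at (snd c p))"
  using assms by (intro smooth_on_differentiable[OF smooth_manifold_transition]) auto

lemma transition_apply:
  "is_chart X c \<Longrightarrow> p \<in> fst c \<Longrightarrow> transition c d (snd c p) = snd d p"
  by (simp add: transition_def chart_inv_left)

lemma open_overlap:
  "smooth_manifold X A \<Longrightarrow> c \<in> A \<Longrightarrow> d \<in> A \<Longrightarrow> open (snd c ` (fst c \<inter> fst d))"
  by (rule smooth_on_open[OF smooth_manifold_transition])

text \<open>The chain rule applied to the composition of two transition maps. This composition
  equals the third transition map only on a neighbourhood of \<open>snd c p\<close>, which is enough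
  for the derivatives.\<close>

lemma frechet_transition_cocycle:
  assumes X: "smooth_manifold X A" and A: "c \<in> A" "d \<in> A" "e \<in> A"
    and p: "p \<in> fst c" "p \<in> fst d" "p \<in> fst e"
  shows "frechet_derivative (transition d e) (at (snd d p))
      (frechet_derivative (transition c d) (at (snd c p)) y) =
    frechet_derivative (transition c e) (at (snd c p)) y"
proof -
  note app = transition_apply[OF smooth_manifold_chart[OF X]]
  have cd: "transition c d differentiable (at (snd c p))"
    by (rule transition_differentiable[OF X A(1,2) p(1,2)])
  have de: "transition d e differentiable (at (transition c d (snd c p)))"
    using transition_differentiable[OF X A(2,3) p(2,3)] app[OF A(1) p(1)] by simp
  have ev: "(transition d e \<circ> transition c d) u = transition c e u"
    if u: "u \<in> snd c ` (fst c \<inter> fst d)" for u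
  proof -
    obtain q where "q \<in> fst c" "q \<in> fst d" "u = snd c q"
      using u by blast
    then show ?thesis by (simp add: app A)
  qed
  have diff: "(transition d e \<circ> transition c d) differentiable (at (snd c p))"
    using cd de by (rule differentiable_chain_at)
  have "frechet_derivative (transition d e \<circ> transition c d) (at (snd c p)) =
      frechet_derivative (transition c e) (at (snd c p))"
    by (rule frechet_derivative_transform_within_open[OF diff open_overlap[OF X A(1,2)] _ ev])
      (use p in auto)
  then show ?thesis
    using frechet_derivative_compose[OF cd de] app[OF A(1) p(1)] by (metis comp_apply)
qed

lemma frechet_transition_self:
  assumes X: "smooth_manifold X A" and A: "c \<in> A" and p: "p \<in> fst c"
  shows "frechet_derivative (transition c c) (at (snd c p)) y = y"
proof -
  have ev: "transition c c u = (\<lambda>u. u) u" if u: "u \<in> snd c ` (fst c \<inter> fst c)" for u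
  proof -
    obtain q where "q \<in> fst c" "u = snd c q"
      using u by blast
    then show ?thesis by (simp add: transition_apply[OF smooth_manifold_chart[OF X A]])
  qed
  have "frechet_derivative (transition c c) (at (snd c p)) = frechet_derivative (\<lambda>u. u) (at (snd c p))"
    by (rule frechet_derivative_transform_within_open[OF
      transition_differentiable[OF X A A p p] open_overlap[OF X A A] _ ev]) (use p in auto)
  then show ?thesis by simp
qed

lemma coords_cases:
  assumes "fst z \<in> chart_image c"
  obtains p y where "p \<in> fst c" "z = (snd c p, y)"
  using assms unfolding chart_image_def by (metis imageE prod.collapse)

lemma tangent_of_coords_apply:
  assumes "smooth_manifold X A" "c \<in> A" "p \<in> fst c"
  shows "tangent_of_coords A c (snd c p, y) = (p, \<lambda>d. if d \<in> A \<and> p \<in> fst d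
    then frechet_derivative (transition c d) (at (snd c p)) y else 0)"
  using assms by (simp add: tangent_of_coords_def chart_inv_left[OF smooth_manifold_chart] cong: if_cong)

lemma tangent_of_coords_self:
  assumes "smooth_manifold X A" "c \<in> A" "fst z \<in> chart_image c"
  shows "snd (tangent_of_coords A c z) c = snd z"
proof -
  obtain p y where p: "p \<in> fst c" "z = (snd c p, y)"
    using assms(3) by (rule coords_cases)
  then show ?thesis
    by (simp add: tangent_of_coords_apply[OF assms(1,2)] assms(2) frechet_transition_self[OF assms(1,2)])
qed

text \<open>The compatibility condition in \<open>tangent_space\<close> is the cocycle identity for
  derivatives of transition maps.\<close>

lemma tangent_of_coords_in_bundle:
  assumes X: "smooth_manifold X A" and c: "c \<in> A" and z: "fst z \<in> chart_image c"
  shows "tangent_of_coords A c z \<in> tangent_bundle A"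
proof -
  obtain p y where p: "p \<in> fst c" "z = (snd c p, y)"
    using z by (rule coords_cases)
  show ?thesis
    unfolding p(2) tangent_of_coords_apply[OF X c p(1)] tangent_bundle_def tangent_space_def
    using c p(1) by (auto simp: frechet_transition_cocycle[OF X c _ _ p(1)])
qed

text \<open>One component determines all others around the point, and the convention of zero
  components elsewhere upgrades this to equality of whole families.\<close>

lemma tangent_bundle_coords:
  assumes X: "smooth_manifold X A" and c: "c \<in> A" and w: "w \<in> tangent_bundle A" "fst w \<in> fst c"
  shows "w = tangent_of_coords A c (snd c (fst w), snd w c)"
proof -
  obtain p v where pv: "w = (p, v)" by (cases w)
  have v_in: "v \<in> tangent_space A p" and p: "p \<in> fst c"
    using w unfolding pv tangent_bundle_def by (simp_all only: mem_Sigma_iff fst_conv)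
  have v: "v d = 0" if "\<not> (d \<in> A \<and> p \<in> fst d)" for d
    using v_in that unfolding tangent_space_def by blast
  have "v d = frechet_derivative (transition c d) (at (snd c p)) (v c)" if "d \<in> A" "p \<in> fst d" for d
    using v_in c p that unfolding tangent_space_def by blast
  with v have "v = (\<lambda>d. if d \<in> A \<and> p \<in> fst d
      then frechet_derivative (transition c d) (at (snd c p)) (v c) else 0)"
    by (intro ext) (metis (full_types))
  then show ?thesis
    unfolding pv fst_conv snd_conv tangent_of_coords_apply[OF X c p] prod.inject by (intro conjI refl)
qed

lemma tangent_bundle_cases:
  assumes X: "smooth_manifold X A" and w: "w \<in> tangent_bundle A"
  obtains c z where "c \<in> A" "fst z \<in> chart_image c" "w = tangent_of_coords A c z"
proof -
  obtain c where c: "c \<in> A" "fst w \<in> fst c"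
    using w by (auto simp: tangent_bundle_def)
  show ?thesis
    by (rule that[OF c(1) _ tangent_bundle_coords[OF X c(1) w c(2)]]) (simp add: chart_image_memI c(2))
qed

lemma tangent_of_coords_scale:
  assumes X: "smooth_manifold X A" and c: "c \<in> A" and z: "fst z \<in> chart_image c"
  shows "tangent_of_coords A c (fst z, r *\<^sub>R snd z) =
    (fst (tangent_of_coords A c z), \<lambda>d. r *\<^sub>R snd (tangent_of_coords A c z) d)"
proof -
  obtain p y where p: "p \<in> fst c" "z = (snd c p, y)"
    using z by (rule coords_cases)
  have "frechet_derivative (transition c d) (at (snd c p)) (r *\<^sub>R y) =
      r *\<^sub>R frechet_derivative (transition c d) (at (snd c p)) y"
    if "d \<in> A" "p \<in> fst d" for d
    using linear_frechet_derivative[OF transition_differentiable[OF X c that(1) p(1) that(2)]]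
    by (rule linear_cmul)
  then show ?thesis
    unfolding p(2) fst_conv snd_conv tangent_of_coords_apply[OF X c p(1)] by (simp add: fun_eq_iff)
qed

lemma tangent_of_coords_slit_iff:
  assumes X: "smooth_manifold X A" and c: "c \<in> A" and z: "fst z \<in> chart_image c"
  shows "tangent_of_coords A c z \<in> slit_tangent_bundle A \<longleftrightarrow> snd z \<noteq> 0"
proof -
  \<comment> \<open>Scaling by \<open>0\<close> turns fibrewise linearity into the statement that
    zero coordinates give the zero family.\<close>
  have "snd (tangent_of_coords A c z) = (\<lambda>_. 0)" if "snd z = 0"
    using tangent_of_coords_scale[OF X c z, of 0] that
    by (metis prod.collapse scale_zero_left snd_conv)
  moreover have "snd z = 0" if "snd (tangent_of_coords A c z) = (\<lambda>_. 0)"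
    using tangent_of_coords_self[OF X c z] that by simp
  ultimately show ?thesis
    using tangent_of_coords_in_bundle[OF X c z]
    by (auto simp: slit_tangent_bundle_def case_prod_unfold)
qed

lemma coord_domain_slit:
  assumes "smooth_manifold X A" "c \<in> A"
  shows "coord_domain A c (slit_tangent_bundle A) = {z. fst z \<in> chart_image c \<and> snd z \<noteq> 0}"
  using tangent_of_coords_slit_iff[OF assms] by (auto simp: coord_domain_def)

text \<open>The choice of chart in \<^const>\<open>differential\<close> is harmless for maps that are restrictions of one
  linear map \<open>P\<close> in suitable charts; both projections of a product are of this form.\<close>

lemma differential_tangent_of_coords:
  fixes C :: "('a, 'm::finite) chart set" and A :: "('b, 'n::finite) chart set"
  assumes Z: "smooth_manifold Z C" and X: "smooth_manifold X A" and P: "bounded_linear P"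
    and adapted: "\<And>e. e \<in> C \<Longrightarrow> \<exists>c\<in>A. h ` fst e \<subseteq> fst c \<and> (\<forall>q\<in>fst e. snd c (h q) = P (snd e q))"
    and e: "e \<in> C" "fst z \<in> chart_image e"
    and c: "c \<in> A" "h ` fst e \<subseteq> fst c" "\<And>q. q \<in> fst e \<Longrightarrow> snd c (h q) = P (snd e q)"
  shows "differential C A h (tangent_of_coords C e z) = tangent_of_coords A c (P (fst z), P (snd z))"
proof -
  obtain p y where p: "p \<in> fst e" and z: "z = (snd e p, y)"
    using e(2) by (rule coords_cases)
  \<comment> \<open>This is the chart that \<open>differential\<close> selects at \<open>p\<close>.
    It may differ from \<open>e\<close>, so it receives its own adapted target chart
    \<open>c'\<close>.\<close>
  define e' where "e' = (SOME e. e \<in> C \<and> p \<in> fst e)"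
  have e': "e' \<in> C" "p \<in> fst e'"
    using someI[of "\<lambda>e. e \<in> C \<and> p \<in> fst e" e] e(1) p by (auto simp: e'_def)
  obtain c' where c': "c' \<in> A" "h ` fst e' \<subseteq> fst c'" "\<And>q. q \<in> fst e' \<Longrightarrow> snd c' (h q) = P (snd e' q)"
    using adapted[OF e'(1)] by blast
  have hp: "h p \<in> fst c" "h p \<in> fst c'"
    using p e' c c' by auto
  note charts = smooth_manifold_chart[OF Z] smooth_manifold_chart[OF X]
  have P_deriv: "(P has_derivative P) (at u)" for u
    using P by (rule bounded_linear_imp_has_derivative)
  \<comment> \<open>Near \<open>snd e p\<close> the maps \<open>P \<circ> transition e e'\<close>
    and \<open>transition c c' \<circ> P\<close> agree, both expressing \<open>h\<close> from
    \<open>e\<close> to \<open>c'\<close>; uniqueness of the derivative gives the equation.\<close>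
  have 1: "P (frechet_derivative (transition e e') (at (snd e p)) y) =
      frechet_derivative (transition c c') (at (snd c (h p))) (P y)"
  proof -
    have "transition e e' differentiable (at (snd e p))"
      by (rule transition_differentiable[OF Z e(1) e'(1) p e'(2)])
    then have l: "((\<lambda>u. P (transition e e' u)) has_derivative
        (\<lambda>y. P (frechet_derivative (transition e e') (at (snd e p)) y))) (at (snd e p))"
      unfolding frechet_derivative_works by (rule bounded_linear.has_derivative[OF P])
    have "transition c c' differentiable (at (P (snd e p)))"
      using transition_differentiable[OF X c(1) c'(1) hp] c(3) p by simp
    then have r: "((\<lambda>u. transition c c' (P u)) has_derivative
        (\<lambda>y. frechet_derivative (transition c c') (at (P (snd e p))) (P y))) (at (snd e p))"
      unfolding frechet_derivative_works by (rule has_derivative_compose[OF P_deriv])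
    have "P (transition e e' u) = transition c c' (P u)" if u: "u \<in> snd e ` (fst e \<inter> fst e')" for u
    proof -
      obtain q where q: "q \<in> fst e" "q \<in> fst e'" "u = snd e q"
        using u by auto
      then have "P (transition e e' u) = snd c' (h q)"
        using transition_apply[OF charts(1)[OF e(1)] q(1)] c'(3) by metis
      moreover have "transition c c' (P u) = snd c' (h q)"
        using transition_apply[OF charts(2)[OF c(1)], of "h q"] c(2,3) q by (metis image_subset_iff)
      ultimately show ?thesis by (rule trans[OF _ sym])
    qed
    from has_derivative_transform_within_open[OF l open_overlap[OF Z e(1) e'(1)] _ this]
    have "((\<lambda>u. transition c c' (P u)) has_derivative
        (\<lambda>y. P (frechet_derivative (transition e e') (at (snd e p)) y))) (at (snd e p))"
      using p e' by auto
    from has_derivative_unique[OF this r] show ?thesis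
      using c(3)[OF p] by metis
  qed
  have 2: "frechet_derivative (snd a \<circ> h \<circ> chart_inv e') (at (snd e' p)) v =
      frechet_derivative (transition c' a) (at (snd c' (h p))) (P v)"
    if a: "a \<in> A" "h p \<in> fst a" for a v
  proof -
    have "transition c' a differentiable (at (P (snd e' p)))"
      using transition_differentiable[OF X c'(1) a(1) hp(2) a(2)] c'(3) e' by simp
    then have r: "((\<lambda>u. transition c' a (P u)) has_derivative
        (\<lambda>y. frechet_derivative (transition c' a) (at (P (snd e' p))) (P y))) (at (snd e' p))"
      unfolding frechet_derivative_works by (rule has_derivative_compose[OF P_deriv])
    have "transition c' a (P u) = (snd a \<circ> h \<circ> chart_inv e') u" if u: "u \<in> snd e' ` (fst e' \<inter> fst e')" for u
    proof -
      obtain q where q: "q \<in> fst e'" "u = snd e' q"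
        using u by auto
      then have "transition c' a (P u) = snd a (h q)"
        using transition_apply[OF charts(2)[OF c'(1)], of "h q"] c'(2,3) by (metis image_subset_iff)
      then show ?thesis
        using q by (simp add: chart_inv_left[OF charts(1)[OF e'(1)]])
    qed
    from has_derivative_transform_within_open[OF r open_overlap[OF Z e'(1) e'(1)] _ this]
    have "((snd a \<circ> h \<circ> chart_inv e') has_derivative
        (\<lambda>y. frechet_derivative (transition c' a) (at (P (snd e' p))) (P y))) (at (snd e' p))"
      using e' by (auto simp: comp_def)
    from frechet_derivative_at[OF this] show ?thesis
      using c'(3)[OF e'(2)] by metis
  qed
  \<comment> \<open>The auxiliary charts \<open>e'\<close> and \<open>c'\<close> disappear by the
    cocycle identity, so the arbitrary choice leaves no trace.\<close>
  have 3: "frechet_derivative (snd a \<circ> h \<circ> chart_inv e') (at (snd e' p))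
      (frechet_derivative (transition e e') (at (snd e p)) y) =
    frechet_derivative (transition c a) (at (snd c (h p))) (P y)"
    if "a \<in> A" "h p \<in> fst a" for a
    using 2[OF that] 1 frechet_transition_cocycle[OF X c(1) c'(1) that(1) hp that(2)] by metis
  have "differential C A h (tangent_of_coords C e z) =
      (h p, \<lambda>a. if a \<in> A \<and> h p \<in> fst a then frechet_derivative (transition c a) (at (snd c (h p))) (P y) else 0)"
    unfolding z tangent_of_coords_apply[OF Z e(1) p] differential_def Let_def fst_conv snd_conv
      e'_def[symmetric]
    by (simp add: e' 3 cong: if_cong)
  also have "\<dots> = tangent_of_coords A c (P (fst z), P (snd z))"
    using tangent_of_coords_apply[OF X c(1) hp(1)] c(3)[OF p] by (simp add: z)
  finally show ?thesis .
qed

text \<open>The differential of the first projection in product coordinates: linear, and the same on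
  base points and on vectors.\<close>

definition proj_fst :: "(real ^ ('m::finite + 'n::finite)) \<times> (real ^ ('m + 'n)) \<Rightarrow> (real ^ 'm) \<times> (real ^ 'm)" where
  "proj_fst z = (join_fst (fst z), join_fst (snd z))"

definition proj_snd :: "(real ^ ('m::finite + 'n::finite)) \<times> (real ^ ('m + 'n)) \<Rightarrow> (real ^ 'n) \<times> (real ^ 'n)" where
  "proj_snd z = (join_snd (fst z), join_snd (snd z))"

lemma bounded_linear_proj_fst: "bounded_linear proj_fst"
  unfolding proj_fst_def[abs_def]
  by (intro bounded_linear_Pair bounded_linear_compose[OF bounded_linear_join_fst]
      bounded_linear_fst bounded_linear_snd)

lemma bounded_linear_proj_snd: "bounded_linear proj_snd"
  unfolding proj_snd_def[abs_def]
  by (intro bounded_linear_Pair bounded_linear_compose[OF bounded_linear_join_snd]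
      bounded_linear_fst bounded_linear_snd)

section \<open>The product bundle and the warped metric in product coordinates\<close>

lemma differential_fst:
  assumes X: "smooth_manifold X A" and Y: "smooth_manifold Y B" and cd: "c \<in> A" "d \<in> B"
    and z: "fst z \<in> chart_image (prod_chart c d)"
  shows "differential (prod_atlas A B) A fst (tangent_of_coords (prod_atlas A B) (prod_chart c d) z) =
    tangent_of_coords A c (proj_fst z)"
  unfolding proj_fst_def
proof (rule differential_tangent_of_coords[OF smooth_manifold_prod[OF X Y] X bounded_linear_join_fst _
      prod_chart_in_prod_atlas[OF cd] z cd(1)])
  show "\<exists>c\<in>A. fst ` fst e \<subseteq> fst c \<and> (\<forall>q\<in>fst e. snd c (fst q) = join_fst (snd e q))"
    if "e \<in> prod_atlas A B" for e
    using that by (auto elim!: prod_atlasE intro!: bexI)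
qed auto

lemma differential_snd:
  assumes X: "smooth_manifold X A" and Y: "smooth_manifold Y B" and cd: "c \<in> A" "d \<in> B"
    and z: "fst z \<in> chart_image (prod_chart c d)"
  shows "differential (prod_atlas A B) B snd (tangent_of_coords (prod_atlas A B) (prod_chart c d) z) =
    tangent_of_coords B d (proj_snd z)"
  unfolding proj_snd_def
proof (rule differential_tangent_of_coords[OF smooth_manifold_prod[OF X Y] Y bounded_linear_join_snd _
      prod_chart_in_prod_atlas[OF cd] z cd(2)])
  show "\<exists>c\<in>B. snd ` fst e \<subseteq> fst c \<and> (\<forall>q\<in>fst e. snd c (snd q) = join_snd (snd e q))"
    if "e \<in> prod_atlas A B" for e
    using that by (auto elim!: prod_atlasE intro!: bexI)
qed auto

text \<open>Turns the domain defined through differentials into the preimage form on which the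
  variables separate.\<close>

lemma coord_domain_prod_slit:
  assumes X: "smooth_manifold X A" and Y: "smooth_manifold Y B" and cd: "c \<in> A" "d \<in> B"
  shows "coord_domain (prod_atlas A B) (prod_chart c d) (prod_slit_bundle A B) =
    proj_fst -` coord_domain A c (slit_tangent_bundle A) \<inter>
    proj_snd -` coord_domain B d (slit_tangent_bundle B)"
  using tangent_of_coords_in_bundle[OF smooth_manifold_prod[OF X Y] prod_chart_in_prod_atlas[OF cd]]
    differential_fst[OF X Y cd] differential_snd[OF X Y cd]
  by (auto simp: coord_domain_def prod_slit_bundle_def proj_fst_def proj_snd_def chart_image_prod_chart)

lemma fst_tangent_of_coords: "fst (tangent_of_coords A c z) = chart_inv c (fst z)"
  by (simp add: tangent_of_coords_def)

text \<open>Here constancy of the warping function enters. It is known on the carrier alone, so the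
  base point must first be located in a chart domain.\<close>

lemma warped_metric_coords:
  assumes X: "smooth_manifold X A" and Y: "smooth_manifold Y B" and cd: "c \<in> A" "d \<in> B"
    and z: "fst z \<in> chart_image (prod_chart c d)" and f: "\<forall>p\<in>topspace X. f p = k"
  shows "warped_metric A B f F1 F2 (tangent_of_coords (prod_atlas A B) (prod_chart c d) z) =
    sqrt ((F1 (tangent_of_coords A c (proj_fst z)))\<^sup>2 + k\<^sup>2 * (F2 (tangent_of_coords B d (proj_snd z)))\<^sup>2)"
proof -
  have "chart_inv c (join_fst (fst z)) \<in> fst c"
    using z by (intro chart_inv_in) (simp add: chart_image_prod_chart)
  also have "fst c \<subseteq> topspace X"
    using X cd(1) by (auto simp: smooth_manifold_def)
  finally have "f (fst (fst (tangent_of_coords (prod_atlas A B) (prod_chart c d) z))) = k"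
    using f by (simp add: fst_tangent_of_coords
      chart_inv_prod_chart[OF smooth_manifold_chart[OF X cd(1)] smooth_manifold_chart[OF Y cd(2)] z])
  then show ?thesis
    by (simp add: warped_metric_def differential_fst[OF X Y cd z] differential_snd[OF X Y cd z])
qed


section \<open>Block diagonal matrices\<close>

definition block_diag :: "real ^ 'm ^ 'm \<Rightarrow> real ^ 'n ^ 'n \<Rightarrow> real ^ ('m::finite + 'n::finite) ^ ('m + 'n)" where
  "block_diag A B = (\<chi> i j. case i of
      Inl a \<Rightarrow> (case j of Inl b \<Rightarrow> A $ a $ b | Inr _ \<Rightarrow> 0)
    | Inr a \<Rightarrow> (case j of Inl _ \<Rightarrow> 0 | Inr b \<Rightarrow> B $ a $ b))"

lemma block_diag_nth [simp]:
  "block_diag A B $ Inl a $ Inl b = A $ a $ b" "block_diag A B $ Inl a $ Inr d = 0"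
  "block_diag A B $ Inr c $ Inl b = 0" "block_diag A B $ Inr c $ Inr d = B $ c $ d"
  by (simp_all add: block_diag_def)

lemma matrix_sum_eq_iff:
  fixes M N :: "'a ^ ('m::finite + 'n::finite) ^ ('m + 'n)"
  shows "M = N \<longleftrightarrow>
    (\<forall>a b. M $ Inl a $ Inl b = N $ Inl a $ Inl b) \<and> (\<forall>a d. M $ Inl a $ Inr d = N $ Inl a $ Inr d) \<and>
    (\<forall>c b. M $ Inr c $ Inl b = N $ Inr c $ Inl b) \<and> (\<forall>c d. M $ Inr c $ Inr d = N $ Inr c $ Inr d)"
  unfolding vec_eq_iff split_sum_all by blast

lemma sum_UNIV_sum:
  fixes g :: "'m::finite + 'n::finite \<Rightarrow> 'a::comm_monoid_add"
  shows "(\<Sum>k\<in>UNIV. g k) = (\<Sum>i\<in>UNIV. g (Inl i)) + (\<Sum>j\<in>UNIV. g (Inr j))"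
  unfolding UNIV_Plus_UNIV[symmetric] by (simp add: sum.Plus comp_def del: UNIV_Plus_UNIV)

lemma block_diag_mult: "block_diag A B ** block_diag A' B' = block_diag (A ** A') (B ** B')"
  by (simp add: matrix_sum_eq_iff matrix_matrix_mult_def sum_UNIV_sum)

lemma block_diag_one: "block_diag (mat 1) (mat 1) = mat 1"
  by (simp add: matrix_sum_eq_iff mat_def)

lemma block_diag_quadratic:
  "\<xi> \<bullet> (block_diag A B *v \<xi>) =
    join_fst \<xi> \<bullet> (A *v join_fst \<xi>) + join_snd \<xi> \<bullet> (B *v join_snd \<xi>)"
  by (simp add: inner_vec_def matrix_vector_mult_def sum_UNIV_sum)

text \<open>\<open>matrix_inv\<close> is a choice among two-sided inverses, and associativity forces
  any such choice to be \<open>B\<close>.\<close>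

lemma matrix_inv_eqI:
  fixes A B :: "real ^ 'n ^ 'n::finite"
  assumes "A ** B = mat 1" "B ** A = mat 1"
  shows "matrix_inv A = B"
proof -
  have "A ** matrix_inv A = mat 1 \<and> matrix_inv A ** A = mat 1"
    unfolding matrix_inv_def by (rule someI[of _ B]) (use assms in blast)
  then have "B ** (A ** matrix_inv A) = B" by simp
  then show ?thesis
    by (simp add: matrix_mul_assoc assms(2))
qed

lemma matrix_inv_mult:
  fixes A :: "real ^ 'n ^ 'n::finite"
  assumes "invertible A"
  shows "A ** matrix_inv A = mat 1" "matrix_inv A ** A = mat 1"
  using someI_ex[OF assms[unfolded invertible_def]] by (simp_all add: matrix_inv_def)

lemma matrix_inv_block_diag:
  assumes "invertible A" "invertible B" "\<kappa> \<noteq> 0"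
  shows "matrix_inv (block_diag A (\<kappa> *\<^sub>R B)) = block_diag (matrix_inv A) ((1 / \<kappa>) *\<^sub>R matrix_inv B)"
  by (rule matrix_inv_eqI)
    (use assms in \<open>simp_all add: block_diag_mult matrix_inv_mult block_diag_one
      matrix_scalar_ac flip: scalar_matrix_assoc\<close>)

text \<open>The quadratic form vanishes on a kernel vector, so the kernel is trivial.\<close>

lemma invertible_positive_definite:
  fixes A :: "real ^ 'n ^ 'n::finite"
  assumes "\<And>\<xi>. \<xi> \<noteq> 0 \<Longrightarrow> \<xi> \<bullet> (A *v \<xi>) > 0"
  shows "invertible A"
proof -
  have "x = 0" if "A *v x = 0" for x
    using assms[of x] that by force
  then show ?thesis
    by (simp add: invertible_left_inverse matrix_left_invertible_ker)
qed


section \<open>Finsler functions in coordinates\<close>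

lemma dir_deriv_sum:
  assumes "\<And>j. h j differentiable (at z)"
  shows "dir_deriv w (\<lambda>u. \<Sum>j\<in>J. c j * h j u) z = (\<Sum>j\<in>J. c j * dir_deriv w (h j) z)"
proof -
  have "((\<lambda>t. \<Sum>j\<in>J. c j * h j (z + t *\<^sub>R w)) has_real_derivative
      (\<Sum>j\<in>J. c j * frechet_derivative (h j) (at z) w)) (at 0)"
    by (intro DERIV_sum DERIV_cmult has_real_derivative_along)
      (use assms in \<open>simp flip: frechet_derivative_works\<close>)
  then show ?thesis
    unfolding dir_deriv_eq_frechet[OF assms] by (simp add: dir_deriv_def DERIV_imp_deriv)
qed

lemma smooth_on_square:
  fixes L :: "'a::euclidean_space \<Rightarrow> real"
  shows "smooth_on U L \<Longrightarrow> smooth_on U (\<lambda>u. (L u)\<^sup>2)"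
  by (simp add: power2_eq_square smooth_on_mult)

text \<open>Euler's identity: \<open>L\<^sup>2\<close> is differentiated twice along the ray through \<open>z\<close>.\<close>

lemma fundamental_tensor_self:
  fixes L :: "(real ^ 'n) \<times> (real ^ 'n::finite) \<Rightarrow> real"
  assumes L: "smooth_on U L" and z: "z \<in> U"
    and hom: "\<And>r. r > 0 \<Longrightarrow> L (fst z, r *\<^sub>R snd z) = r * L z"
  shows "snd z \<bullet> (fundamental_tensor L z *v snd z) = (L z)\<^sup>2"
proof -
  define N where "N = (\<lambda>u. (L u)\<^sup>2)"
  define y where "y = snd z"
  define w where "w = (0 :: real ^ 'n, y)"
  have N: "smooth_on U N"
    unfolding N_def by (rule smooth_on_square[OF L])
  have dyN: "dy j N differentiable (at z)" for j
    unfolding dy_eq_dir_deriv by (rule smooth_on_differentiable[OF smooth_on_dir_deriv[OF N] z])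
  \<comment> \<open>Homogeneity holds for positive factors, hence \<open>t > - 1\<close>. This is an
    open condition around \<open>0\<close>, so it suffices for derivatives there.\<close>
  have ray: "N (z + t *\<^sub>R w) = (1 + t)\<^sup>2 * N z" if "t > - 1" for t
  proof -
    have "z + t *\<^sub>R w = (fst z, (1 + t) *\<^sub>R snd z)"
      by (simp add: w_def y_def plus_prod_def algebra_simps)
    then show ?thesis
      using hom[of "1 + t"] that by (simp add: N_def power_mult_distrib)
  qed
  have "dir_deriv w N (z + t *\<^sub>R w) = 2 * (1 + t) * N z" if t: "t > - 1" for t
  proof -
    have "\<forall>\<^sub>F s in nhds 0. s \<in> {- 1 - t <..}"
      by (rule eventually_nhds_in_open) (use t in auto)
    then have "\<forall>\<^sub>F s in nhds 0. N (z + t *\<^sub>R w + s *\<^sub>R w) = (1 + t + s)\<^sup>2 * N z"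
    proof eventually_elim
      case (elim s)
      then show ?case
        using ray[of "t + s"] by (simp add: algebra_simps)
    qed
    then have "dir_deriv w N (z + t *\<^sub>R w) = deriv (\<lambda>s. (1 + t + s)\<^sup>2 * N z) 0"
      unfolding dir_deriv_def by (intro deriv_cong_ev refl)
    also have "\<dots> = 2 * (1 + t) * N z"
      by (rule DERIV_imp_deriv) (auto intro!: derivative_eq_intros)
    finally show ?thesis .
  qed
  moreover have "\<forall>\<^sub>F t in nhds 0. t \<in> {- 1 :: real <..}"
    by (rule eventually_nhds_in_open) auto
  ultimately have "dir_deriv w (dir_deriv w N) z = deriv (\<lambda>t. 2 * (1 + t) * N z) 0"
    unfolding dir_deriv_def[of w "dir_deriv w N"]
    by (intro deriv_cong_ev refl) (auto elim: eventually_mono)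
  also have "\<dots> = 2 * N z"
    by (rule DERIV_imp_deriv) (auto intro!: derivative_eq_intros)
  \<comment> \<open>The same second derivative is now expanded in coordinates; the factor
    \<open>2\<close> matches the \<open>1/2\<close> in \<open>fundamental_tensor\<close>.\<close>
  finally have "2 * N z = dir_deriv w (dir_deriv w N) z" ..
  also have "\<dots> = dir_deriv w (\<lambda>u. \<Sum>j\<in>UNIV. y $ j * dy j N u) z"
    unfolding w_def
    by (rule dir_deriv_cong[OF smooth_on_open[OF N] z])
      (rule dir_deriv_fibre_sum[OF smooth_on_differentiable[OF N]])
  also have "\<dots> = (\<Sum>j\<in>UNIV. y $ j * dir_deriv w (dy j N) z)"
    by (rule dir_deriv_sum[OF dyN])
  also have "\<dots> = (\<Sum>j\<in>UNIV. \<Sum>i\<in>UNIV. y $ j * (y $ i * dy i (dy j N) z))"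
    by (simp add: w_def dir_deriv_fibre_sum[OF dyN] sum_distrib_left)
  also have "\<dots> = (\<Sum>i\<in>UNIV. \<Sum>j\<in>UNIV. y $ j * (y $ i * dy i (dy j N) z))"
    by (rule sum.swap)
  also have "\<dots> = 2 * (y \<bullet> (fundamental_tensor L z *v y))"
    unfolding inner_vec_def matrix_vector_mult_def fundamental_tensor_def N_def
    by (simp add: sum_distrib_left mult_ac)
  finally show ?thesis
    by (simp add: y_def N_def)
qed

section \<open>The curvature computation on a product of coordinate domains\<close>

lemma proj_inl [simp]:
  "proj_fst (axis (Inl i) 1, 0) = (axis i 1, 0)" "proj_snd (axis (Inl i) 1, 0) = 0"
  "proj_fst (0, axis (Inl i) 1) = (0, axis i 1)" "proj_snd (0, axis (Inl i) 1) = 0"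
  by (simp_all add: proj_fst_def proj_snd_def vec_eq_iff prod_eq_iff axis_def)

text \<open>The zeros here and in \<open>proj_inl\<close> are the side conditions by which
  simplification selects the right derivative rule for each pair of indices.\<close>

lemma proj_inr [simp]:
  "proj_fst (axis (Inr i) 1, 0) = 0" "proj_snd (axis (Inr i) 1, 0) = (axis i 1, 0)"
  "proj_fst (0, axis (Inr i) 1) = 0" "proj_snd (0, axis (Inr i) 1) = (0, axis i 1)"
  by (simp_all add: proj_fst_def proj_snd_def vec_eq_iff prod_eq_iff axis_def)

text \<open>Detaches the computation from manifolds: only functions on open sets of coordinates
  remain. \<open>L\<close> is prescribed on the product domain alone, so every identity below is
  local, and \<open>\<kappa>\<close> stands for the squared warping constant.\<close>

locale product_coords =
  fixes U1 :: "((real ^ 'm::finite) \<times> (real ^ 'm)) set" and U2 :: "((real ^ 'n::finite) \<times> (real ^ 'n)) set"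
    and L1 L2 L and \<kappa> :: real
  assumes L1: "smooth_on U1 L1" and L2: "smooth_on U2 L2" and \<kappa>: "\<kappa> > 0"
    and pos1: "\<And>z \<xi>. z \<in> U1 \<Longrightarrow> \<xi> \<noteq> 0 \<Longrightarrow> \<xi> \<bullet> (fundamental_tensor L1 z *v \<xi>) > 0"
    and pos2: "\<And>z \<xi>. z \<in> U2 \<Longrightarrow> \<xi> \<noteq> 0 \<Longrightarrow> \<xi> \<bullet> (fundamental_tensor L2 z *v \<xi>) > 0"
    and L: "\<And>z. z \<in> proj_fst -` U1 \<inter> proj_snd -` U2 \<Longrightarrow>
      L z = sqrt ((L1 (proj_fst z))\<^sup>2 + \<kappa> * (L2 (proj_snd z))\<^sup>2)"
begin

abbreviation "D \<equiv> proj_fst -` U1 \<inter> proj_snd -` U2"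
abbreviation "N \<equiv> \<lambda>u. (L u)\<^sup>2"
abbreviation "N1 \<equiv> \<lambda>u. (L1 u)\<^sup>2"
abbreviation "N2 \<equiv> \<lambda>u. (L2 u)\<^sup>2"

lemmas linear_proj = bounded_linear.linear[OF bounded_linear_proj_fst]
  bounded_linear.linear[OF bounded_linear_proj_snd]

lemma open_D: "open D"
  using smooth_on_open[OF L1] smooth_on_open[OF L2]
  by (intro open_Int continuous_open_vimage)
    (simp_all add: linear_continuous_at bounded_linear_proj_fst bounded_linear_proj_snd)

lemma square: "z \<in> D \<Longrightarrow> (L z)\<^sup>2 = (L1 (proj_fst z))\<^sup>2 + \<kappa> * (L2 (proj_snd z))\<^sup>2"
  using \<kappa> by (simp add: L)

lemma deriv_fst:
  assumes "z \<in> D" "proj_snd w = 0"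
  shows "dir_deriv w N z = dir_deriv (proj_fst w) N1 (proj_fst z)"
  by (rule dir_deriv_separated[where a = N1 and b = "\<lambda>u. \<kappa> * N2 u", OF open_D assms(1) square linear_proj assms(2)])

lemma deriv_snd:
  assumes z: "z \<in> D" and w: "proj_fst w = 0"
  shows "dir_deriv w N z = \<kappa> * dir_deriv (proj_snd w) N2 (proj_snd z)"
proof -
  have "(L u)\<^sup>2 = \<kappa> * (L2 (proj_snd u))\<^sup>2 + (L1 (proj_fst u))\<^sup>2" if "u \<in> D" for u
    using square[OF that] by simp
  from dir_deriv_separated[where a = "\<lambda>u. \<kappa> * N2 u" and b = N1,
      OF open_D z this linear_proj(2) linear_proj(1) w]
  have "dir_deriv w N z = dir_deriv (proj_snd w) (\<lambda>u. \<kappa> * N2 u) (proj_snd z)" .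
  also have "\<dots> = \<kappa> * dir_deriv (proj_snd w) N2 (proj_snd z)"
    using z by (intro dir_deriv_cmult smooth_on_differentiable[OF smooth_on_square[OF L2]]) auto
  finally show ?thesis .
qed

text \<open>On the whole open set \<open>D\<close> the first derivative is a function of one
  projection, so separation applies again with zero as second summand.\<close>

lemma deriv_fst_fst:
  assumes "z \<in> D" "proj_snd w = 0" "proj_snd v = 0"
  shows "dir_deriv v (dir_deriv w N) z =
    dir_deriv (proj_fst v) (dir_deriv (proj_fst w) N1) (proj_fst z)"
  using dir_deriv_separated[where b = "\<lambda>_. 0", OF open_D assms(1) _ linear_proj assms(3)]
    deriv_fst[OF _ assms(2)] by simp

lemma deriv_snd_snd:
  assumes z: "z \<in> D" and w: "proj_fst w = 0" "proj_fst v = 0"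
  shows "dir_deriv v (dir_deriv w N) z =
    \<kappa> * dir_deriv (proj_snd v) (dir_deriv (proj_snd w) N2) (proj_snd z)"
proof -
  have "dir_deriv v (dir_deriv w N) z =
      dir_deriv (proj_snd v) (\<lambda>u. \<kappa> * dir_deriv (proj_snd w) N2 u) (proj_snd z)"
    using dir_deriv_separated[where b = "\<lambda>_. 0", OF open_D z _ linear_proj(2) linear_proj(1) w(2)]
      deriv_snd[OF _ w(1)] by simp
  also have "\<dots> = \<kappa> * dir_deriv (proj_snd v) (dir_deriv (proj_snd w) N2) (proj_snd z)"
    using z by (intro dir_deriv_cmult smooth_on_differentiable[OF smooth_on_dir_deriv[OF
      smooth_on_square[OF L2]]]) auto
  finally show ?thesis .
qed

text \<open>After a derivative in a base direction only base variables remain, and a fibre direction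
  does not move them.\<close>

lemma deriv_snd_fst:
  assumes "z \<in> D" "proj_snd w = 0" "proj_fst v = 0"
  shows "dir_deriv v (dir_deriv w N) z = 0"
  by (rule dir_deriv_zero[where a = "dir_deriv (proj_fst w) N1",
    OF open_D assms(1) deriv_fst[OF _ assms(2)] linear_proj(1) assms(3)])

lemma deriv_fst_snd:
  assumes "z \<in> D" "proj_fst w = 0" "proj_snd v = 0"
  shows "dir_deriv v (dir_deriv w N) z = 0"
  by (rule dir_deriv_zero[where a = "\<lambda>u. \<kappa> * dir_deriv (proj_snd w) N2 u",
    OF open_D assms(1) deriv_snd[OF _ assms(2)] linear_proj(2) assms(3)])

lemma fundamental_tensor_eq:
  assumes "z \<in> D"
  shows "fundamental_tensor L z =
    block_diag (fundamental_tensor L1 (proj_fst z)) (\<kappa> *\<^sub>R fundamental_tensor L2 (proj_snd z))"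
  unfolding matrix_sum_eq_iff fundamental_tensor_def dy_eq_dir_deriv
  by (simp add: deriv_fst_fst[OF assms] deriv_snd_snd[OF assms] deriv_snd_fst[OF assms] deriv_fst_snd[OF assms])

text \<open>One block of a nonzero vector may vanish, so each block contributes a nonnegative term
  and at least one of them a positive term.\<close>

lemma positive_definite:
  assumes z: "z \<in> D" and "\<xi> \<noteq> 0"
  shows "\<xi> \<bullet> (fundamental_tensor L z *v \<xi>) > 0"
proof -
  let ?a = "join_fst \<xi> \<bullet> (fundamental_tensor L1 (proj_fst z) *v join_fst \<xi>)"
  let ?b = "join_snd \<xi> \<bullet> (fundamental_tensor L2 (proj_snd z) *v join_snd \<xi>)"
  have a: "?a \<ge> 0" "join_fst \<xi> \<noteq> 0 \<Longrightarrow> ?a > 0"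
    using pos1[of "proj_fst z" "join_fst \<xi>"] z by (cases "join_fst \<xi> = 0"; force)+
  have b: "?b \<ge> 0" "join_snd \<xi> \<noteq> 0 \<Longrightarrow> ?b > 0"
    using pos2[of "proj_snd z" "join_snd \<xi>"] z by (cases "join_snd \<xi> = 0"; force)+
  have "join_fst \<xi> \<noteq> 0 \<or> join_snd \<xi> \<noteq> 0"
    using assms(2) join_zero_iff by blast
  then have "?a + \<kappa> * ?b > 0"
    using a b \<kappa> by (metis add_nonneg_pos add_pos_nonneg mult_nonneg_nonneg mult_pos_pos less_imp_le)
  then show ?thesis
    by (simp add: fundamental_tensor_eq[OF z] block_diag_quadratic flip: scaleR_matrix_vector_assoc)
qed

lemma matrix_inv_eq:
  assumes z: "z \<in> D"
  shows "matrix_inv (fundamental_tensor L z) =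
    block_diag (matrix_inv (fundamental_tensor L1 (proj_fst z)))
      ((1 / \<kappa>) *\<^sub>R matrix_inv (fundamental_tensor L2 (proj_snd z)))"
  unfolding fundamental_tensor_eq[OF z]
  using z \<kappa> by (intro matrix_inv_block_diag invertible_positive_definite pos1 pos2) auto

lemma snd_nth: "snd z $ Inl i = snd (proj_fst z) $ i" "snd z $ Inr j = snd (proj_snd z) $ j"
  by (simp_all add: proj_fst_def proj_snd_def)

text \<open>The factor \<open>\<kappa>\<close> cancels between the metric and its inverse, so the spray splits.\<close>

lemma spray_coeff_fst:
  assumes z: "z \<in> D"
  shows "spray_coeff L (Inl i) z = spray_coeff L1 i (proj_fst z)"
  unfolding spray_coeff_def dx_eq_dir_deriv dy_eq_dir_deriv matrix_inv_eq[OF z] sum_UNIV_sum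
  by (simp add: deriv_fst[OF z] deriv_fst_fst[OF z] deriv_fst_snd[OF z] snd_nth)

lemma spray_coeff_snd:
  assumes z: "z \<in> D"
  shows "spray_coeff L (Inr j) z = spray_coeff L2 j (proj_snd z)"
proof -
  \<comment> \<open>This is the bracket in the spray formula of the fibre. With
    \<open>\<kappa>\<close> pulled out of it, the factor meets \<open>1 / \<kappa>\<close> from the
    inverse block.\<close>
  let ?r = "\<lambda>l. (\<Sum>k\<in>UNIV. dir_deriv (0, axis l 1) (dir_deriv (axis k 1, 0) N2) (proj_snd z) * snd (proj_snd z) $ k)
      - dir_deriv (axis l 1, 0) N2 (proj_snd z)"
  have "(\<Sum>k\<in>UNIV. \<kappa> * dir_deriv (0, axis l 1) (dir_deriv (axis k 1, 0) N2) (proj_snd z) * snd (proj_snd z) $ k)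
      - \<kappa> * dir_deriv (axis l 1, 0) N2 (proj_snd z) = \<kappa> * ?r l" for l
    by (simp add: sum_distrib_left right_diff_distrib mult.assoc)
  then show ?thesis
    unfolding spray_coeff_def dx_eq_dir_deriv dy_eq_dir_deriv matrix_inv_eq[OF z] sum_UNIV_sum
    using \<kappa> by (simp add: deriv_snd[OF z] deriv_snd_snd[OF z] deriv_snd_fst[OF z] snd_nth)
qed

abbreviation "S1 \<equiv> \<lambda>u. \<Sum>s\<in>UNIV. dy s (spray_coeff L1 s) u"
abbreviation "S2 \<equiv> \<lambda>u. \<Sum>s\<in>UNIV. dy s (spray_coeff L2 s) u"
abbreviation "S \<equiv> \<lambda>u. \<Sum>s\<in>UNIV. dy s (spray_coeff L s) u"

text \<open>The divergence is a trace: each spray component is differentiated only in its own index,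
  hence within its own factor.\<close>

lemma divergence_eq:
  assumes z: "z \<in> D"
  shows "S z = S1 (proj_fst z) + S2 (proj_snd z)"
proof -
  have "dy (Inl i) (spray_coeff L (Inl i)) z = dy i (spray_coeff L1 i) (proj_fst z)" for i
    using dir_deriv_separated[where b = "\<lambda>_. 0", OF open_D z _ linear_proj] spray_coeff_fst
    unfolding dy_eq_dir_deriv by simp
  moreover have "dy (Inr j) (spray_coeff L (Inr j)) z = dy j (spray_coeff L2 j) (proj_snd z)" for j
    using dir_deriv_separated[where b = "\<lambda>_. 0", OF open_D z _ linear_proj(2) linear_proj(1)] spray_coeff_snd
    unfolding dy_eq_dir_deriv by simp
  ultimately show ?thesis
    by (simp add: sum_UNIV_sum)
qed

lemma dy_divergence:
  assumes z: "z \<in> D"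
  shows "dy (Inl i) S z = dy i S1 (proj_fst z)" "dy (Inr j) S z = dy j S2 (proj_snd z)"
proof -
  show "dy (Inl i) S z = dy i S1 (proj_fst z)"
    using dir_deriv_separated[where a = S1 and b = S2 and w = "(0, axis (Inl i) 1)",
      OF open_D z divergence_eq linear_proj]
    by (simp add: dy_eq_dir_deriv)
  have "S u = S2 (proj_snd u) + S1 (proj_fst u)" if "u \<in> D" for u
    using divergence_eq[OF that] by simp
  from dir_deriv_separated[where a = S2 and b = S1 and w = "(0, axis (Inr j) 1)",
      OF open_D z this linear_proj(2) linear_proj(1)]
  show "dy (Inr j) S z = dy j S2 (proj_snd z)"
    by (simp add: dy_eq_dir_deriv)
qed

lemma dy_dy_divergence:
  assumes z: "z \<in> D"
  shows "dy (Inl i') (dy (Inl i) S) z = dy i' (dy i S1) (proj_fst z)"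
    "dy (Inr j) (dy (Inl i) S) z = 0"
    "dy (Inl i) (dy (Inr j) S) z = 0"
    "dy (Inr j') (dy (Inr j) S) z = dy j' (dy j S2) (proj_snd z)"
proof -
  show "dy (Inl i') (dy (Inl i) S) z = dy i' (dy i S1) (proj_fst z)"
    unfolding dy_eq_dir_deriv[of "Inl i'"] dy_eq_dir_deriv[of "i'"]
    using dir_deriv_separated[where a = "dy i S1" and b = "\<lambda>_. 0" and w = "(0, axis (Inl i') 1)",
      OF open_D z _ linear_proj] dy_divergence(1) by simp
  show "dy (Inr j') (dy (Inr j) S) z = dy j' (dy j S2) (proj_snd z)"
    unfolding dy_eq_dir_deriv[of "Inr j'"] dy_eq_dir_deriv[of "j'"]
    using dir_deriv_separated[where a = "dy j S2" and b = "\<lambda>_. 0" and w = "(0, axis (Inr j') 1)",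
      OF open_D z _ linear_proj(2) linear_proj(1)] dy_divergence(2) by simp
  show "dy (Inr j) (dy (Inl i) S) z = 0"
    unfolding dy_eq_dir_deriv[of "Inr j"]
    by (rule dir_deriv_zero[where a = "dy i S1", OF open_D z dy_divergence(1) linear_proj(1)]) simp_all
  show "dy (Inl i) (dy (Inr j) S) z = 0"
    unfolding dy_eq_dir_deriv[of "Inl i"]
    by (rule dir_deriv_zero[where a = "dy j S2", OF open_D z dy_divergence(2) linear_proj(2)]) simp_all
qed

lemma mean_berwald_zero:
  assumes z: "z \<in> D"
    and "\<And>i j. mean_berwald L1 i j (proj_fst z) = 0" "\<And>i j. mean_berwald L2 i j (proj_snd z) = 0"
  shows "mean_berwald L i j z = 0"
  using assms(2,3) unfolding mean_berwald_def
  by (cases i; cases j) (simp_all add: dy_dy_divergence[OF z])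

text \<open>The square root is smooth where its argument is positive; the assumption makes the base
  summand positive, and the fibre summand is nonnegative.\<close>

lemma smooth:
  assumes "\<And>z. z \<in> U1 \<Longrightarrow> L1 z \<noteq> 0"
  shows "smooth_on D L"
proof -
  have 1: "smooth_on D (\<lambda>u. N1 (proj_fst u))"
    by (rule smooth_on_subset[OF smooth_on_linear_right[OF smooth_on_square[OF L1]
      bounded_linear_proj_fst] open_D]) simp
  have 2: "smooth_on D (\<lambda>u. N2 (proj_snd u))"
    by (rule smooth_on_subset[OF smooth_on_linear_right[OF smooth_on_square[OF L2]
      bounded_linear_proj_snd] open_D]) simp
  have "smooth_on D (\<lambda>u. sqrt (N1 (proj_fst u) + \<kappa> * N2 (proj_snd u)))"
  proof (rule smooth_on_sqrt)
    show "smooth_on D (\<lambda>u. N1 (proj_fst u) + \<kappa> * N2 (proj_snd u))"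
      by (intro smooth_on_add smooth_on_mult smooth_on_const 1 2 open_D)
    show "N1 (proj_fst u) + \<kappa> * N2 (proj_snd u) > 0" if "u \<in> D" for u
      using that assms[of "proj_fst u"] \<kappa> by (intro add_pos_nonneg) auto
  qed
  then show ?thesis
    by (rule smooth_on_cong) (simp add: L)
qed

end

section \<open>Warped products with constant warping function\<close>

lemma finsler_metric_coords_homogeneous:
  assumes F: "finsler_metric_on A D F" and X: "smooth_manifold X A" and c: "c \<in> A"
    and z: "fst z \<in> chart_image c" and r: "r > 0"
  shows "F (tangent_of_coords A c (fst z, r *\<^sub>R snd z)) = r * F (tangent_of_coords A c z)"
proof -
  have "\<forall>(p, v)\<in>tangent_bundle A. \<forall>r>0. F (p, \<lambda>c. r *\<^sub>R v c) = r * F (p, v)"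
    using F by (simp add: finsler_metric_on_def)
  from bspec[OF this tangent_of_coords_in_bundle[OF X c z]] show ?thesis
    using r by (simp add: tangent_of_coords_scale[OF X c z] case_prod_unfold)
qed

text \<open>Strong convexity is tested on the vector \<open>snd z\<close> itself, where the
  quadratic form has the value \<open>F\<^sup>2\<close>.\<close>

lemma finsler_metric_coords_nonzero:
  assumes F: "finsler_metric_on A (slit_tangent_bundle A) F" and X: "smooth_manifold X A" and c: "c \<in> A"
    and z: "z \<in> coord_domain A c (slit_tangent_bundle A)"
  shows "F (tangent_of_coords A c z) \<noteq> 0"
proof -
  let ?L = "F \<circ> tangent_of_coords A c"
  have z': "fst z \<in> chart_image c" "snd z \<noteq> 0"
    using z by (simp_all add: coord_domain_slit[OF X c])
  have L: "smooth_on (coord_domain A c (slit_tangent_bundle A)) ?L"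
    and "snd z \<bullet> (fundamental_tensor ?L z *v snd z) > 0"
    using F c z z' by (simp_all add: finsler_metric_on_def Let_def)
  moreover have "snd z \<bullet> (fundamental_tensor ?L z *v snd z) = (?L z)\<^sup>2"
    by (rule fundamental_tensor_self[OF L z])
      (use finsler_metric_coords_homogeneous[OF F X c z'(1)] in simp)
  ultimately show ?thesis by auto
qed

theorem corollary4p1:
  fixes X1 :: "'a topology" and A1 :: "('a, 'n1::finite) chart set"
    and F1 :: "'a \<times> ('a, 'n1) tvec \<Rightarrow> real"
    and X2 :: "'b topology" and A2 :: "('b, 'n2::finite) chart set"
    and F2 :: "'b \<times> ('b, 'n2) tvec \<Rightarrow> real"
    and f :: "'a \<Rightarrow> real"
  assumes "weakly_berwald_finsler_manifold X1 A1 F1"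
    and "weakly_berwald_finsler_manifold X2 A2 F2"
    and "\<forall>p\<in>topspace X1. f p > 0"
    and "smooth_function A1 f"
    and "\<exists>k. \<forall>p\<in>topspace X1. f p = k"
  shows "weakly_berwald_finsler_manifold_on
           (prod_topology X1 X2) (prod_atlas A1 A2) (prod_slit_bundle A1 A2)
           (warped_metric A1 A2 f F1 F2)"
proof -
  let ?A = "prod_atlas A1 A2" and ?D = "prod_slit_bundle A1 A2" and ?F = "warped_metric A1 A2 f F1 F2"
  let ?S1 = "slit_tangent_bundle A1" and ?S2 = "slit_tangent_bundle A2"
  have X1: "smooth_manifold X1 A1" and F1: "finsler_metric_on A1 ?S1 F1" and B1: "weakly_berwald_on A1 ?S1 F1"
    using assms(1) by (simp_all add: weakly_berwald_finsler_manifold_def weakly_berwald_finsler_manifold_on_def)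
  have X2: "smooth_manifold X2 A2" and F2: "finsler_metric_on A2 ?S2 F2" and B2: "weakly_berwald_on A2 ?S2 F2"
    using assms(2) by (simp_all add: weakly_berwald_finsler_manifold_def weakly_berwald_finsler_manifold_on_def)
  have X: "smooth_manifold (prod_topology X1 X2) ?A"
    by (rule smooth_manifold_prod[OF X1 X2])
  \<comment> \<open>On an empty base the given constant is unconstrained and may fail to be
    positive, so \<open>1\<close> is taken instead.\<close>
  obtain k where k: "\<forall>p\<in>topspace X1. f p = k" "k > 0"
  proof (cases "topspace X1 = {}")
    case True
    then show ?thesis by (intro that[of 1]) auto
  next
    case False
    with assms(3,5) show ?thesis by (metis ex_in_conv that)
  qed
  note coords = warped_metric_coords[OF X1 X2 _ _ _ k(1)]

  have coords_product: "product_coords (coord_domain A1 c ?S1) (coord_domain A2 d ?S2)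
      (F1 \<circ> tangent_of_coords A1 c) (F2 \<circ> tangent_of_coords A2 d)
      (?F \<circ> tangent_of_coords ?A (prod_chart c d)) (k\<^sup>2)"
    if cd: "c \<in> A1" "d \<in> A2" for c d
  proof
    fix z
    assume "z \<in> proj_fst -` coord_domain A1 c ?S1 \<inter> proj_snd -` coord_domain A2 d ?S2"
    then have "fst z \<in> chart_image (prod_chart c d)"
      by (auto simp: coord_domain_def chart_image_prod_chart proj_fst_def proj_snd_def)
    then show "(?F \<circ> tangent_of_coords ?A (prod_chart c d)) z =
        sqrt (((F1 \<circ> tangent_of_coords A1 c) (proj_fst z))\<^sup>2 + k\<^sup>2 * ((F2 \<circ> tangent_of_coords A2 d) (proj_snd z))\<^sup>2)"
      by (simp add: coords[OF cd])
  qed (use F1 F2 cd k(2) in \<open>simp_all add: finsler_metric_on_def Let_def\<close>)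

  \<comment> \<open>A nonzero base component already makes the whole coordinate vector
    nonzero.\<close>
  have subset: "?D \<subseteq> slit_tangent_bundle ?A"
  proof
    fix w
    assume w: "w \<in> ?D"
    then have "w \<in> tangent_bundle ?A"
      by (simp add: prod_slit_bundle_def)
    then obtain e z where e: "e \<in> ?A" "fst z \<in> chart_image e" "w = tangent_of_coords ?A e z"
      by (rule tangent_bundle_cases[OF X])
    obtain c d where cd: "e = prod_chart c d" "c \<in> A1" "d \<in> A2"
      using e(1) by (rule prod_atlasE)
    have "tangent_of_coords A1 c (proj_fst z) \<in> ?S1"
      using w differential_fst[OF X1 X2 cd(2,3), of z] e(2) by (simp add: e(3) cd(1) prod_slit_bundle_def)
    moreover have "fst (proj_fst z) \<in> chart_image c"
      using e(2) by (simp add: cd(1) chart_image_prod_chart proj_fst_def)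
    ultimately have "join_fst (snd z) \<noteq> 0"
      using tangent_of_coords_slit_iff[OF X1 cd(2)] by (simp add: proj_fst_def)
    then have "snd z \<noteq> 0"
      by (simp add: join_zero_iff)
    then show "w \<in> slit_tangent_bundle ?A"
      using tangent_of_coords_slit_iff[OF X e(1,2)] e(3) by simp
  qed

  \<comment> \<open>Fibre scaling commutes with both projections, so each summand gains
    \<open>r\<^sup>2\<close> and the positive \<open>r\<close> leaves the square root.\<close>
  have homogeneous: "?F (p, \<lambda>c. r *\<^sub>R v c) = r * ?F (p, v)"
    if w: "(p, v) \<in> tangent_bundle ?A" and r: "r > 0" for p v r
  proof -
    obtain e z where e: "e \<in> ?A" "fst z \<in> chart_image e" "(p, v) = tangent_of_coords ?A e z"
      using w by (rule tangent_bundle_cases[OF X])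
    obtain c d where cd: "e = prod_chart c d" "c \<in> A1" "d \<in> A2"
      using e(1) by (rule prod_atlasE)
    have z: "fst z \<in> chart_image (prod_chart c d)" "fst (proj_fst z) \<in> chart_image c"
        "fst (proj_snd z) \<in> chart_image d"
      using e(2) by (simp_all add: cd(1) chart_image_prod_chart proj_fst_def proj_snd_def)
    have "(p, \<lambda>c. r *\<^sub>R v c) = tangent_of_coords ?A e (fst z, r *\<^sub>R snd z)"
      using tangent_of_coords_scale[OF X e(1,2)] by (simp flip: e(3))
    moreover have "proj_fst (fst z, r *\<^sub>R snd z) = (fst (proj_fst z), r *\<^sub>R snd (proj_fst z))"
      "proj_snd (fst z, r *\<^sub>R snd z) = (fst (proj_snd z), r *\<^sub>R snd (proj_snd z))"
      by (simp_all add: proj_fst_def proj_snd_def vec_eq_iff)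
    ultimately have "?F (p, \<lambda>c. r *\<^sub>R v c) =
        sqrt (r\<^sup>2 * ((F1 (tangent_of_coords A1 c (proj_fst z)))\<^sup>2 + k\<^sup>2 * (F2 (tangent_of_coords A2 d (proj_snd z)))\<^sup>2))"
      using z(1) finsler_metric_coords_homogeneous[OF F1 X1 cd(2) z(2) r]
        finsler_metric_coords_homogeneous[OF F2 X2 cd(3) z(3) r]
      by (simp add: cd(1) coords[OF cd(2,3)] power_mult_distrib algebra_simps)
    also have "\<dots> = r * ?F (p, v)"
      using r by (simp add: e(3) cd(1) coords[OF cd(2,3) z(1)] real_sqrt_mult)
    finally show ?thesis .
  qed

  \<comment> \<open>Continuity is claimed for all vectors, including zero ones; the square root is
    continuous at \<open>0\<close> although not smooth there.\<close>
  have continuous: "continuous_on (chart_image (prod_chart c d) \<times> UNIV) (?F \<circ> tangent_of_coords ?A (prod_chart c d))"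
    if cd: "c \<in> A1" "d \<in> A2" for c d
  proof -
    let ?U = "chart_image (prod_chart c d) \<times> (UNIV :: (real ^ ('n1 + 'n2)) set)"
    have F: "continuous_on (chart_image c \<times> UNIV) (F1 \<circ> tangent_of_coords A1 c)"
      "continuous_on (chart_image d \<times> UNIV) (F2 \<circ> tangent_of_coords A2 d)"
      using F1 F2 cd by (simp_all add: finsler_metric_on_def Let_def)
    have "proj_fst ` ?U \<subseteq> chart_image c \<times> UNIV" "proj_snd ` ?U \<subseteq> chart_image d \<times> UNIV"
      by (auto simp: chart_image_prod_chart proj_fst_def proj_snd_def)
    then have "continuous_on ?U (\<lambda>z. (F1 \<circ> tangent_of_coords A1 c) (proj_fst z))"
      "continuous_on ?U (\<lambda>z. (F2 \<circ> tangent_of_coords A2 d) (proj_snd z))"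
      using continuous_on_compose2[OF F(1) linear_continuous_on[OF bounded_linear_proj_fst]]
        continuous_on_compose2[OF F(2) linear_continuous_on[OF bounded_linear_proj_snd]] by blast+
    then have "continuous_on ?U (\<lambda>z. sqrt (((F1 \<circ> tangent_of_coords A1 c) (proj_fst z))\<^sup>2 +
        k\<^sup>2 * ((F2 \<circ> tangent_of_coords A2 d) (proj_snd z))\<^sup>2))"
      by (intro continuous_intros)
    then show ?thesis
      by (rule continuous_on_eq) (auto simp: coords[OF cd])
  qed

  have finsler: "finsler_metric_on ?A ?D ?F"
    unfolding finsler_metric_on_def Let_def
  proof (intro conjI ballI allI impI)
    fix e
    assume "e \<in> ?A"
    then obtain c d where e: "e = prod_chart c d" and cd: "c \<in> A1" "d \<in> A2"
      by (rule prod_atlasE)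
    interpret product_coords "coord_domain A1 c ?S1" "coord_domain A2 d ?S2"
      "F1 \<circ> tangent_of_coords A1 c" "F2 \<circ> tangent_of_coords A2 d"
      "?F \<circ> tangent_of_coords ?A (prod_chart c d)" "k\<^sup>2"
      by (rule coords_product[OF cd])
    show "continuous_on (chart_image e \<times> UNIV) (?F \<circ> tangent_of_coords ?A e)"
      unfolding e by (rule continuous[OF cd])
    show "smooth_on (coord_domain ?A e ?D) (?F \<circ> tangent_of_coords ?A e)"
      unfolding e coord_domain_prod_slit[OF X1 X2 cd]
      by (rule smooth) (use finsler_metric_coords_nonzero[OF F1 X1 cd(1)] in simp)
    show "\<xi> \<bullet> (fundamental_tensor (?F \<circ> tangent_of_coords ?A e) z *v \<xi>) > 0"
      if "z \<in> coord_domain ?A e ?D" "\<xi> \<noteq> 0" for z \<xi>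
      using that positive_definite unfolding e coord_domain_prod_slit[OF X1 X2 cd] by blast
  qed (use subset homogeneous in \<open>auto simp: warped_metric_def\<close>)

  have "weakly_berwald_on ?A ?D ?F"
    unfolding weakly_berwald_on_def
  proof (intro ballI allI)
    fix e z i j
    assume "e \<in> ?A" and z: "z \<in> coord_domain ?A e ?D"
    from this(1) obtain c d where e: "e = prod_chart c d" and cd: "c \<in> A1" "d \<in> A2"
      by (rule prod_atlasE)
    interpret product_coords "coord_domain A1 c ?S1" "coord_domain A2 d ?S2"
      "F1 \<circ> tangent_of_coords A1 c" "F2 \<circ> tangent_of_coords A2 d"
      "?F \<circ> tangent_of_coords ?A (prod_chart c d)" "k\<^sup>2"
      by (rule coords_product[OF cd])
    show "mean_berwald (?F \<circ> tangent_of_coords ?A e) i j z = 0"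
      using z B1 B2 cd unfolding e coord_domain_prod_slit[OF X1 X2 cd] weakly_berwald_on_def
      by (intro mean_berwald_zero) auto
  qed
  with X finsler show ?thesis
    by (simp add: weakly_berwald_finsler_manifold_on_def)
qed

end
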